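(* Let $q\ge 1$ and $1\le p\le q$ be integers, and let $f$ be an exponential polynomial of order $q$ in the normalized form $f(z)=H_0(z)e^{w_0z^q}+H_1(z)e^{w_1z^q}+\cdots+H_m(z)e^{w_mz^q}$, where the coefficients $H_j$ are exponential polynomials of order $\rho(H_j)\le q-p$. Then the Nevanlinna characteristic of $f$ satisfies $$T(r,f)=C(\operatorname{co}(W_f^0))\frac{r^q}{2\pi}+O\left(r^{q-p}+\log r\right)\quad (r\to\infty).$$
   Context: An exponential polynomial is an entire function $P_0e^{Q_0}+\cdots+P_ne^{Q_n}$ with polynomials $P_j,Q_j$; the $Q_j$ are taken pairwise different with $Q_j(0)=0$, and the order is $\max_j\deg Q_j$. Ordinary polynomials are exponential polynomials of order $0$. Every exponential polynomial of order $q\ge1$ can be written in the normalized form $f(z)=\sum_{j=0}^m H_j(z)e^{w_jz^q}$, where $w_0=0$, the leading coefficients $w_0,\ldots,w_m\in\mathbb{C}$ are pairwise distinct (so $w_j\ne0$ for $j\ge1$), $H_1,\ldots,H_m\not\equiv0$, possibly $H_0\equiv 0$, and the $H_j$ are exponential polynomials of order $\le q-p$ for some integer $1\le p\le q$ (if $p=q$ the $H_j$ are ordinary polynomials). $W_f^0=\{0,\overline{w}_1,\ldots,\overline{w}_m\}$. For a finite set $G\subset\mathbb{C}$, $\operatorname{co}(G)$ is its convex hull and $C(\operatorname{co}(G))$ is the circumference (perimeter) of the convex hull; if the hull is a segment, this is twice its length. *)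

theory Defs
  imports "HOL-Complex_Analysis.Complex_Analysis" "HOL-Library.Landau_Symbols"
begin

subsection \<open>Exponential polynomials\<close>

text \<open>
  The exponents \<^term>\<open>Q j\<close> are pairwise different and vanish at \<^term>\<open>0::complex\<close>; the order is the
  largest degree among them. For this to depend only on the function, a term with zero
  coefficient must not contribute a nonconstant exponent. A zero coefficient is admitted
  only with \<^prop>\<open>Q j = 0\<close>, so that the zero function is an exponential polynomial of order 0.
\<close>

definition exp_poly_of_order :: "nat \<Rightarrow> (complex \<Rightarrow> complex) \<Rightarrow> bool" where
  "exp_poly_of_order d f \<longleftrightarrow>
     (\<exists>(n::nat) (P :: nat \<Rightarrow> complex poly) (Q :: nat \<Rightarrow> complex poly).
        (\<forall>z. f z = (\<Sum>j\<le>n. poly (P j) z * exp (poly (Q j) z))) \<and>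
        inj_on Q {..n} \<and>
        (\<forall>j\<le>n. poly (Q j) 0 = 0) \<and>
        (\<forall>j\<le>n. P j = 0 \<longrightarrow> Q j = 0) \<and>
        d = Max ((\<lambda>j. degree (Q j)) ` {..n}))"

subsection \<open>Nevanlinna characteristic\<close>

text \<open>
  These are the usual definitions for a function meromorphic in the plane. At a zero of
  \<^term>\<open>f\<close> the proximity integrand is \<open>0\<close>, because \<^prop>\<open>ln 0 = (0::real)\<close>.
\<close>

definition proximity_function :: "real \<Rightarrow> (complex \<Rightarrow> complex) \<Rightarrow> real" where
  "proximity_function r f =
     1 / (2 * pi) * integral {0..2 * pi} (\<lambda>\<theta>. max 0 (ln (norm (f (of_real r * cis \<theta>)))))"

text \<open>The order \<^const>\<open>zorder\<close> is negative at a pole, its absolute value being the multiplicity.\<close>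

definition pole_count :: "real \<Rightarrow> (complex \<Rightarrow> complex) \<Rightarrow> nat" where
  "pole_count t f = (\<Sum>z | norm z \<le> t \<and> is_pole f z. nat (- zorder f z))"

definition integrated_counting_function :: "real \<Rightarrow> (complex \<Rightarrow> complex) \<Rightarrow> real" where
  "integrated_counting_function r f =
     integral {0..r} (\<lambda>t. (real (pole_count t f) - real (pole_count 0 f)) / t)
       + real (pole_count 0 f) * ln r"

definition nevanlinna_characteristic :: "real \<Rightarrow> (complex \<Rightarrow> complex) \<Rightarrow> real" where
  "nevanlinna_characteristic r f = proximity_function r f + integrated_counting_function r f"

subsection \<open>Circumference of a convex polygon\<close>

text \<open>
  For a polygon with nonempty interior this is the sum of the side lengths, the diameter of
  a side being its length. A segment counts twice, and a point has circumference \<open>0\<close>.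
\<close>

definition circumference :: "complex set \<Rightarrow> real" where
  "circumference K =
     (if aff_dim K = 2 then (\<Sum>E | E edge_of K. diameter E) else 2 * diameter K)"

end

theory Submission
  imports Defs
begin

text \<open>
  Write \<open>U z\<close> for the maximum of \<open>Re (w\<^sub>j z\<^sup>q)\<close> and \<open>N(r) = r\<^bsup>q-p\<^esup> + log r\<close>. Since \<open>f\<close> is entire, the
  characteristic is the circle mean of \<open>log\<^sup>+ |f|\<close>. By Cauchy's formula for the perimeter (integrate
  the support function), the circle mean of \<open>U\<close> is the main term, and
  \<open>log\<^sup>+ |f| \<le> U + O(N)\<close> pointwise, which gives the upper bound.

  For the lower bound, eliminating the terms of \<open>f\<close> one by one with first order differential operators
  gives \<open>A\<^sub>j exp (w\<^sub>j z\<^sup>q) = \<Sum>\<^sub>i c\<^sub>i f\<^bsup>(i)\<^esup>\<close> with \<open>A\<^sub>j \<noteq> 0\<close> and \<open>log |c\<^sub>i| = O(N)\<close>. By Cauchy's estimates,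
  \<open>U + log |A|\<close> at a point \<open>z\<close> of modulus \<open>r - 2 s\<close>, where \<open>s\<close> is of order \<open>r\<^bsup>1-p\<^esup>\<close>, is therefore at most
  \<open>O(N)\<close> plus the maximum of \<open>log\<^sup>+ |f|\<close> on the disc of radius \<open>s\<close> about \<open>z\<close>. Now majorize
  \<open>log\<^sup>+ |f|\<close> and \<open>U\<close> on the circle of radius \<open>r\<close> by harmonic functions \<open>Re g\<close> and \<open>Re G\<close>, tight up to \<open>1\<close>. Then
  \<open>Re (G - g) + O(N)\<close> is a positive harmonic function \<open>v\<close>, and by Harnack's inequality
  \<open>log\<^sup>+ |f| \<le> U + 3 (Re G - U) - v / 3 + O(N)\<close> on the small disc, with the right hand side taken at \<open>z\<close>.
  Hence \<open>v / 3 \<le> 3 (Re G - U) - log |A| + O(N)\<close>, and taking means, with Jensen's inequality for \<open>A\<close>,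
  bounds the mean of \<open>v\<close>, which is that of \<open>U - log\<^sup>+ |f|\<close> up to \<open>O(N)\<close>.
\<close>

subsection \<open>Circle means and harmonic majorants\<close>

definition circle_mean :: "(complex \<Rightarrow> real) \<Rightarrow> real \<Rightarrow> real" where
  "circle_mean u r = integral {0..2 * pi} (\<lambda>t. u (of_real r * cis t)) / (2 * pi)"

lemma circle_integrable:
  fixes u :: "complex \<Rightarrow> real"
  assumes "continuous_on (sphere 0 r) u" "0 \<le> r"
  shows "(\<lambda>t. u (of_real r * cis t)) integrable_on {a..b}"
proof (rule integrable_continuous_interval)
  have "continuous_on {a..b} (u \<circ> (\<lambda>t. of_real r * cis t))"
    by (rule continuous_on_compose)
      (auto intro!: continuous_intros continuous_on_subset[OF assms(1)]
        simp: norm_mult assms(2))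
  then show "continuous_on {a..b} (\<lambda>t. u (of_real r * cis t))"
    by (simp add: o_def)
qed

lemma circle_mean_mono:
  assumes "continuous_on (sphere 0 r) u" "continuous_on (sphere 0 r) v" "0 \<le> r"
    and "\<And>z. norm z = r \<Longrightarrow> u z \<le> v z"
  shows "circle_mean u r \<le> circle_mean v r"
  unfolding circle_mean_def
  by (intro divide_right_mono integral_le circle_integrable assms) (auto simp: norm_mult assms)

lemma circle_mean_add:
  assumes "continuous_on (sphere 0 r) u" "continuous_on (sphere 0 r) v" "0 \<le> r"
  shows "circle_mean (\<lambda>z. u z + v z) r = circle_mean u r + circle_mean v r"
  unfolding circle_mean_def
  by (simp add: integral_add circle_integrable assms add_divide_distrib)

lemma circle_mean_diff:
  assumes "continuous_on (sphere 0 r) u" "continuous_on (sphere 0 r) v" "0 \<le> r"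
  shows "circle_mean (\<lambda>z. u z - v z) r = circle_mean u r - circle_mean v r"
  unfolding circle_mean_def
  by (simp add: integral_diff circle_integrable assms diff_divide_distrib)

lemma circle_mean_cmult: "circle_mean (\<lambda>z. c * u z) r = c * circle_mean u r"
  unfolding circle_mean_def by simp

lemma circle_mean_const: "circle_mean (\<lambda>z. c) r = c"
  unfolding circle_mean_def by simp

lemma circle_mean_Re_holomorphic:
  assumes "g holomorphic_on UNIV" "0 < r"
  shows "circle_mean (\<lambda>z. Re (g z)) r = Re (g 0)"
proof -
  have "((\<lambda>u. g u / (u - 0)) has_contour_integral (2 * of_real pi * \<i> * g 0)) (circlepath 0 r)"
    by (rule Cauchy_integral_circlepath_simple)
      (use assms in \<open>auto intro: holomorphic_on_subset\<close>)
  then have "((\<lambda>t. g (0 + of_real r * cis t) / (0 + of_real r * cis t - 0) * of_real r * \<i> * cis t) has_integral (2 * of_real pi * \<i> * g 0)) {0..2*pi}"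
    unfolding circlepath_def
    by (subst (asm) has_contour_integral_part_circlepath_iff) (auto simp: assms)
  then have "((\<lambda>t. \<i> * g (of_real r * cis t)) has_integral (2 * of_real pi * \<i> * g 0)) {0..2*pi}"
    using assms(2) by (simp add: mult_ac)
  \<comment> \<open>The imaginary part of \<open>\<i> * g\<close> is the real part of
    \<open>g\<close>, which turns Cauchy's formula into the real mean value property.\<close>
  then have "((\<lambda>t. Im (\<i> * g (of_real r * cis t))) has_integral Im (2 * of_real pi * \<i> * g 0)) {0..2*pi}"
    by (rule has_integral_Im)
  then have "((\<lambda>t. Re (g (of_real r * cis t))) has_integral (2 * pi * Re (g 0))) {0..2*pi}"
    by simp
  then show ?thesis
    unfolding circle_mean_def by (simp add: integral_unique)
qed

section \<open>Harmonic majorants on a circle\<close>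

lemma Re_poly_mult_cnj_poly_on_circle:
  fixes p q :: "complex poly"
  shows "\<exists>s. \<forall>z. norm z = r \<longrightarrow> Re (poly p z * cnj (poly q z)) = Re (poly s z)"
proof -
  \<comment> \<open>On the circle \<open>z * cnj z\<close> is \<open>r\<^sup>2\<close>, so
    \<open>z ^ i * cnj z ^ j\<close> is a constant times a power of \<open>z\<close> or of
    \<open>cnj z\<close>. A power of \<open>cnj z\<close> may be conjugated, since only the real
    part matters.\<close>
  define P where "P i j =
    (if j \<le> i then monom (coeff p i * cnj (coeff q j) * of_real r ^ (2 * j)) (i - j)
     else monom (cnj (coeff p i) * coeff q j * of_real r ^ (2 * i)) (j - i))" for i j
  have zc: "z ^ n * cnj z ^ n = of_real r ^ (2 * n)" if "norm z = r" for z :: complex and n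
    using complex_norm_square[of z] that
    by (simp add: power_mult power_mult_distrib[symmetric])
  have P: "Re (coeff p i * z ^ i * cnj (coeff q j * z ^ j)) = Re (poly (P i j) z)"
    if z: "norm z = r" for z i j
  proof (cases "j \<le> i")
    case True
    then have "z ^ i = z ^ (i - j) * z ^ j" by (simp flip: power_add)
    then have "coeff p i * z ^ i * cnj (coeff q j * z ^ j)
        = coeff p i * cnj (coeff q j) * (z ^ j * cnj z ^ j) * z ^ (i - j)"
      by (simp add: mult_ac)
    then show ?thesis
      using True by (simp only: zc[OF z] P_def poly_monom if_True)
  next
    case False
    then have "z ^ j = z ^ (j - i) * z ^ i" by (simp flip: power_add)
    then have "cnj (coeff p i * z ^ i * cnj (coeff q j * z ^ j))
        = cnj (coeff p i) * coeff q j * (z ^ i * cnj z ^ i) * z ^ (j - i)"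
      by (simp add: mult_ac)
    then have "Re (cnj (coeff p i * z ^ i * cnj (coeff q j * z ^ j))) = Re (poly (P i j) z)"
      using False by (simp only: zc[OF z] P_def poly_monom if_False)
    then show ?thesis by (simp only: cnj.sel)
  qed
  show ?thesis
  proof (intro exI allI impI)
    fix z :: complex assume z: "norm z = r"
    have "poly p z * cnj (poly q z)
        = (\<Sum>i\<le>degree p. \<Sum>j\<le>degree q. coeff p i * z ^ i * cnj (coeff q j * z ^ j))"
      unfolding poly_altdef cnj_sum by (simp only: sum_product)
    then show "Re (poly p z * cnj (poly q z))
        = Re (poly (\<Sum>i\<le>degree p. \<Sum>j\<le>degree q. P i j) z)"
      by (simp only: Re_sum poly_sum P[OF z])
  qed
qed

text \<open>Stone--Weierstrass for the real parts of polynomials. These majorants take the place of the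
  Poisson integral.\<close>

lemma harmonic_majorant_on_circle:
  assumes "continuous_on (sphere 0 r) u" "(0::real) < e"
  obtains g where "g holomorphic_on UNIV"
    "\<And>z. norm z = r \<Longrightarrow> u z \<le> Re (g z)" "\<And>z. norm z = r \<Longrightarrow> Re (g z) \<le> u z + e"
proof -
  define R where "R v \<longleftrightarrow> (\<exists>p. \<forall>z. norm z = r \<longrightarrow> v z = Re (poly p z))" for v :: "complex \<Rightarrow> real"
  have "\<exists>v. R v \<and> (\<forall>z\<in>sphere 0 r. \<bar>u z - v z\<bar> < e / 2)"
  proof (rule Stone_Weierstrass_HOL[where P = R])
    show "R (\<lambda>z. c)" for c
      unfolding R_def by (rule exI[of _ "[:of_real c:]"]) simp
    show "continuous_on (sphere 0 r) v" if R: "R v" for v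
    proof -
      obtain p where "\<forall>z. norm z = r \<longrightarrow> v z = Re (poly p z)" using R unfolding R_def by blast
      then have "continuous_on (sphere 0 r) v \<longleftrightarrow> continuous_on (sphere 0 r) (\<lambda>z. Re (poly p z))"
        by (intro continuous_on_cong) auto
      then show ?thesis by (auto intro!: continuous_intros)
    qed
    show "R (\<lambda>x. v x + w x)" if R: "R v \<and> R w" for v w
    proof -
      obtain p q where "\<forall>z. norm z = r \<longrightarrow> v z = Re (poly p z)" "\<forall>z. norm z = r \<longrightarrow> w z = Re (poly q z)"
        using R unfolding R_def by blast
      then show ?thesis unfolding R_def by (intro exI[of _ "p + q"]) simp
    qed
    show "R (\<lambda>x. v x * w x)" if R: "R v \<and> R w" for v w
    proof -
      obtain p q where pq: "\<forall>z. norm z = r \<longrightarrow> v z = Re (poly p z)" "\<forall>z. norm z = r \<longrightarrow> w z = Re (poly q z)"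
        using R unfolding R_def by blast
      obtain s where s: "\<And>z. norm z = r \<Longrightarrow> Re (poly p z * cnj (poly q z)) = Re (poly s z)"
        using Re_poly_mult_cnj_poly_on_circle[of r p q] by blast
      \<comment> \<open>For complex \<open>a\<close> and \<open>b\<close>,
        \<open>Re a * Re b = Re (a * b + a * cnj b) / 2\<close>. On the circle the second product
        has the real part of a polynomial, which gives closure under products.\<close>
      have "v z * w z = Re (poly (smult (1/2) (p * q + s)) z)" if "norm z = r" for z
        using s[OF that] that pq by (simp add: field_simps)
      then show ?thesis unfolding R_def by blast
    qed
    show "\<exists>v. R v \<and> v x \<noteq> v y" if "x \<in> sphere 0 r \<and> y \<in> sphere 0 r \<and> x \<noteq> y" for x y
    proof (cases "Re x = Re y")
      case False
      then show ?thesis unfolding R_def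
        by (intro exI[of _ Re] conjI exI[of _ "[:0, 1:]"]) auto
    next
      case True
      then have "Im x \<noteq> Im y" using that complex_eqI by blast
      then show ?thesis unfolding R_def
        by (intro exI[of _ Im] conjI exI[of _ "[:0, -\<i>:]"]) auto
    qed
    show "compact (sphere (0 :: complex) r)" "continuous_on (sphere 0 r) u" "0 < e / 2"
      using assms by simp_all
  qed
  then obtain v where R: "R v" and v: "\<forall>z\<in>sphere 0 r. \<bar>u z - v z\<bar> < e / 2"
    by blast
  obtain p where p: "\<forall>z. norm z = r \<longrightarrow> v z = Re (poly p z)"
    using R unfolding R_def by blast
  \<comment> \<open>Raising the approximation by \<open>e / 2\<close> turns an error of
    \<open>e / 2\<close> on both sides into an upward error of at most \<open>e\<close>.\<close>
  show thesis
  proof (rule that[of "\<lambda>z. poly p z + of_real (e / 2)"])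
    show "(\<lambda>z. poly p z + of_real (e / 2)) holomorphic_on UNIV"
      by (intro holomorphic_intros)
    show "u z \<le> Re (poly p z + of_real (e / 2))" "Re (poly p z + of_real (e / 2)) \<le> u z + e"
      if "norm z = r" for z
    proof -
      have "v z = Re (poly p z)" "\<bar>u z - v z\<bar> < e / 2" using p v that by auto
      then show "u z \<le> Re (poly p z + of_real (e / 2))" "Re (poly p z + of_real (e / 2)) \<le> u z + e"
        unfolding abs_less_iff by simp_all
    qed
  qed
qed

section \<open>Maximum principle, Harnack's inequality and Jensen's inequality on discs\<close>

lemma norm_le_exp_Re_disc:
  assumes "f holomorphic_on UNIV" "g holomorphic_on UNIV"
    and "\<And>z. norm z = r \<Longrightarrow> norm (f z) \<le> exp (Re (g z))"
    and "norm \<zeta> \<le> r" 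
  shows "norm (f \<zeta>) \<le> exp (Re (g \<zeta>))"
proof -
  \<comment> \<open>Dividing by \<open>exp g\<close> replaces the subharmonicity of log |f| by the
    maximum modulus principle, which also covers the zeros of \<open>f\<close>.\<close>
  have hol: "(\<lambda>z. f z * exp (- g z)) holomorphic_on UNIV"
    by (intro holomorphic_intros assms)
  have "norm (f \<zeta> * exp (- g \<zeta>)) \<le> 1"
  proof (rule maximum_modulus_frontier[where S = "cball 0 r" and f = "\<lambda>z. f z * exp (- g z)"])
    show "(\<lambda>z. f z * exp (- g z)) holomorphic_on interior (cball 0 r)"
      using hol holomorphic_on_subset by blast
    show "continuous_on (closure (cball 0 r)) (\<lambda>z. f z * exp (- g z))"
      using hol holomorphic_on_imp_continuous_on continuous_on_subset by blast
    show "norm (f z * exp (- g z)) \<le> 1" if "z \<in> frontier (cball 0 r)" for z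
    proof -
      have "norm z = r" using that by auto
      then have "norm (f z) * exp (- Re (g z)) \<le> exp (Re (g z)) * exp (- Re (g z))"
        by (intro mult_right_mono assms) auto
      then show ?thesis by (simp add: norm_mult flip: exp_add)
    qed
  qed (use assms(4) in auto)
  then have "norm (f \<zeta>) * exp (- Re (g \<zeta>)) \<le> 1"
    by (simp only: norm_mult norm_exp_eq_Re uminus_complex.sel)
  then show ?thesis
    by (simp add: exp_minus field_simps)
qed

text \<open>The minimum principle for harmonic functions, obtained by comparing the constant 1 with
  \<open>exp g\<close>.\<close>

lemma Re_nonneg_disc:
  assumes "g holomorphic_on UNIV" "\<And>z. norm z = r \<Longrightarrow> 0 \<le> Re (g z)" "norm \<zeta> \<le> r"
  shows "0 \<le> Re (g \<zeta>)"
  using norm_le_exp_Re_disc[of "\<lambda>_. 1" g r \<zeta>] assms by auto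

text \<open>The Moebius map taking \<open>g 0\<close> to 0 sends the right half-plane into the unit
  disc, so Schwarz's lemma applies. For \<open>norm w \<le> 1 / 2\<close> it yields a quadratic
  inequality for \<open>Re (g w)\<close> whose roots are one third of \<open>Re (g 0)\<close> and
  three times it.\<close>

lemma Harnack_unit_disc:
  assumes hol: "g holomorphic_on ball 0 1" and pos: "\<And>z. norm z < 1 \<Longrightarrow> 0 < Re (g z)"
    and w: "norm w \<le> 1 / 2"
  shows "Re (g 0) \<le> 3 * Re (g w)" "Re (g w) \<le> 3 * Re (g 0)"
proof -
  define a where "a = g 0"
  have a: "0 < Re a" using pos[of 0] by (simp add: a_def)
  define h where "h z = (g z - a) / (g z + cnj a)" for z
  have nz: "g z + cnj a \<noteq> 0" if "norm z < 1" for z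
  proof -
    have "0 < Re (g z + cnj a)" using pos[OF that] a by simp
    then show ?thesis by (metis less_irrefl zero_complex.sel(1))
  qed
  have "norm (h w) \<le> norm w"
  proof (rule Schwarz_Lemma(1))
    show "h holomorphic_on ball 0 1"
      unfolding h_def by (intro holomorphic_intros hol) (use nz in auto)
    show "h 0 = 0" by (simp add: h_def a_def)
    show "norm (h z) < 1" if "norm z < 1" for z
    proof -
      have "(norm (g z - a))\<^sup>2 < (norm (g z + cnj a))\<^sup>2"
        unfolding cmod_power2 using pos[OF that] a
        by (simp add: power2_eq_square algebra_simps)
      then have "norm (g z - a) < norm (g z + cnj a)"
        using norm_ge_zero power_less_imp_less_base by blast
      then show ?thesis using nz[OF that] by (simp add: h_def norm_divide divide_less_eq)
    qed
    show "norm w < 1" using w by simp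
  qed
  then have "norm (g w - a) \<le> norm w * norm (g w + cnj a)"
    using nz[of w] w by (simp add: h_def norm_divide divide_le_eq)
  also have "\<dots> \<le> 1 / 2 * norm (g w + cnj a)"
    using w by (intro mult_right_mono) auto
  finally have "norm (g w - a) \<le> 1 / 2 * norm (g w + cnj a)" .
  then have "(norm (g w - a))\<^sup>2 \<le> (1 / 2 * norm (g w + cnj a))\<^sup>2"
    by (intro power_mono) auto
  moreover have "(Re (g w) - Re a)\<^sup>2 + (Im (g w) - Im a)\<^sup>2 = (norm (g w - a))\<^sup>2"
    "(norm (g w + cnj a))\<^sup>2 = (Re (g w) + Re a)\<^sup>2 + (Im (g w) - Im a)\<^sup>2"
    by (simp_all add: cmod_power2)
  ultimately have "(Re (g w) - Re a)\<^sup>2 + (Im (g w) - Im a)\<^sup>2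
      \<le> ((Re (g w) + Re a)\<^sup>2 + (Im (g w) - Im a)\<^sup>2) / 4"
    by (simp add: power_mult_distrib power_divide)
  moreover have "4 * x \<le> y" if "x + t \<le> (y + t) / 4" "0 \<le> t" for x y t :: real
    using that by simp
  ultimately have "4 * (Re (g w) - Re a)\<^sup>2 \<le> (Re (g w) + Re a)\<^sup>2"
    by (meson zero_le_power2)
  then have *: "(3 * Re (g w) - Re a) * (Re (g w) - 3 * Re a) \<le> 0"
    by (simp add: power2_eq_square algebra_simps)
  have pw: "0 < Re (g w)" using pos w by simp
  show "Re (g 0) \<le> 3 * Re (g w)" "Re (g w) \<le> 3 * Re (g 0)"
    using * a pw unfolding a_def[symmetric] by (auto simp: mult_le_0_iff)
qed

lemma Harnack_half_disc:
  assumes hol: "g holomorphic_on ball z (2 * s)"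
    and pos: "\<And>\<zeta>. \<zeta> \<in> ball z (2 * s) \<Longrightarrow> 0 \<le> Re (g \<zeta>)"
    and s: "0 < s" and w: "dist z w \<le> s"
  shows "Re (g z) \<le> 3 * Re (g w)" "Re (g w) \<le> 3 * Re (g z)"
proof -
  define v where "v = (w - z) / of_real (2 * s)"
  have v: "norm v \<le> 1 / 2"
    using w s by (simp add: v_def norm_divide dist_norm norm_minus_commute field_simps)
  have zv: "z + of_real (2 * s) * v = w" using s by (simp add: v_def)
  have inb: "z + of_real (2 * s) * x \<in> ball z (2 * s)" if "norm x < 1" for x
    using that s by (simp add: dist_norm norm_mult)
  \<comment> \<open>The version on the unit disc wants a strictly positive real part, hence the
    added \<open>e\<close>, which is removed at the end.\<close>
  have *: "Re (g z) + e \<le> 3 * (Re (g w) + e) \<and> Re (g w) + e \<le> 3 * (Re (g z) + e)" if "0 < e" for e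
  proof -
    define h where "h x = g (z + of_real (2 * s) * x) + of_real e" for x
    have "h holomorphic_on ball 0 1"
      unfolding h_def
      by (intro holomorphic_intros holomorphic_on_compose_gen[OF _ hol, unfolded o_def])
        (use inb in auto)
    moreover have "0 < Re (h x)" if "norm x < 1" for x
      using pos[OF inb[OF that]] \<open>0 < e\<close> by (simp add: h_def)
    ultimately show ?thesis
      using Harnack_unit_disc[of h v] v zv by (simp add: h_def)
  qed
  show "Re (g z) \<le> 3 * Re (g w)"
    by (rule field_le_epsilon) (use *[of "_ / 2"] in \<open>force simp: field_simps\<close>)
  show "Re (g w) \<le> 3 * Re (g z)"
    by (rule field_le_epsilon) (use *[of "_ / 2"] in \<open>force simp: field_simps\<close>)
qed

text \<open>\<open>c + n * ln \<rho>\<close> is the logarithm of the modulus of the lowest Taylor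
  term of \<open>A\<close> at 0. Working with a continuous majorant \<open>B\<close> of log |A|
  avoids integrals that are singular at the zeros. \<open>B\<close> is replaced by a harmonic
  \<open>Re g\<close>, and Cauchy's estimate is applied to \<open>A * exp (- g)\<close>, which is
  bounded by 1 on the circle.\<close>

lemma Jensen_lower_bound:
  assumes hol: "A holomorphic_on UNIV" and nz: "A \<noteq> (\<lambda>_. 0)"
  shows "\<exists>c n. \<forall>\<rho> B. 0 < \<rho> \<longrightarrow> continuous_on (sphere 0 \<rho>) B \<longrightarrow>
      (\<forall>z. norm z = \<rho> \<longrightarrow> norm (A z) \<le> exp (B z)) \<longrightarrow> c + real n * ln \<rho> \<le> circle_mean B \<rho>"
proof -
  have "\<exists>n. (deriv ^^ n) A 0 \<noteq> 0"
  proof (rule ccontr)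
    assume "\<nexists>n. (deriv ^^ n) A 0 \<noteq> 0"
    then have "A w = 0" for w
      using holomorphic_fun_eq_0_on_connected[of A UNIV 0 w] hol by auto
    then show False using nz by auto
  qed
  define n where "n = (LEAST n. (deriv ^^ n) A 0 \<noteq> 0)"
  have n: "(deriv ^^ n) A 0 \<noteq> 0"
    unfolding n_def by (rule LeastI_ex) fact
  have less: "(deriv ^^ i) A 0 = 0" if "i < n" for i
    using that not_less_Least unfolding n_def by blast
  define c where "c = ln (norm ((deriv ^^ n) A 0) / fact n)"
  show ?thesis
  proof (intro exI[of _ c] exI[of _ n] allI impI)
    fix \<rho> B
    assume \<rho>: "0 < \<rho>" and B: "continuous_on (sphere 0 \<rho>) B"
      and le: "\<forall>z. norm z = \<rho> \<longrightarrow> norm (A z) \<le> exp (B z)"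
    show "c + real n * ln \<rho> \<le> circle_mean B \<rho>"
    proof (rule field_le_epsilon)
      fix e :: real assume e: "0 < e"
      obtain g where g: "g holomorphic_on UNIV" "\<And>z. norm z = \<rho> \<Longrightarrow> B z \<le> Re (g z)"
        "\<And>z. norm z = \<rho> \<Longrightarrow> Re (g z) \<le> B z + e"
        using harmonic_majorant_on_circle[OF B e] by blast
      have cg: "continuous_on (sphere 0 \<rho>) (\<lambda>z. Re (g z))"
        using g(1) holomorphic_on_imp_continuous_on
        by (intro continuous_intros) (meson continuous_on_subset subset_UNIV)
      define F where "F z = A z * exp (- g z)" for z
      have holF: "F holomorphic_on UNIV"
        unfolding F_def by (intro holomorphic_intros hol g)
      have "norm ((deriv ^^ n) F 0) \<le> fact n * 1 / \<rho> ^ n"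
      proof (rule Cauchy_inequality)
        show "F holomorphic_on ball 0 \<rho>" using holF holomorphic_on_subset by blast
        show "continuous_on (cball 0 \<rho>) F"
          using holF holomorphic_on_imp_continuous_on continuous_on_subset by blast
        show "norm (F x) \<le> 1" if "norm (0 - x) = \<rho>" for x
        proof -
          have "norm (A x) * exp (- Re (g x)) \<le> exp (Re (g x)) * exp (- Re (g x))"
            using le g(2)[of x] that by (intro mult_right_mono) (auto elim: order_trans)
          then show ?thesis by (simp add: F_def norm_mult flip: exp_add)
        qed
      qed (use \<rho> in auto)
      \<comment> \<open>All lower derivatives of \<open>A\<close> vanish at 0, so a single term of
        Leibniz's formula survives.\<close>
      moreover have "(deriv ^^ n) F 0 = (deriv ^^ n) A 0 * exp (- g 0)"
      proof -
        have "(deriv ^^ n) F 0 = (\<Sum>i = 0..n. of_nat (n choose i) * (deriv ^^ i) A 0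
            * (deriv ^^ (n-i)) (\<lambda>z. exp (- g z)) 0)"
          unfolding F_def
          by (rule higher_deriv_mult[of _ UNIV]) (auto intro!: holomorphic_intros hol g)
        also have "\<dots> = (\<Sum>i\<in>{n}. of_nat (n choose i) * (deriv ^^ i) A 0
            * (deriv ^^ (n-i)) (\<lambda>z. exp (- g z)) 0)"
          by (rule sum.mono_neutral_right) (auto simp: less)
        finally show ?thesis by simp
      qed
      ultimately have "norm ((deriv ^^ n) A 0) * exp (- Re (g 0)) \<le> fact n * 1 / \<rho> ^ n"
        by (simp only: norm_mult norm_exp_eq_Re uminus_complex.sel)
      then have "norm ((deriv ^^ n) A 0) / fact n * \<rho> ^ n \<le> exp (Re (g 0))"
        using \<rho> by (simp add: exp_minus field_simps)
      then have "ln (norm ((deriv ^^ n) A 0) / fact n * \<rho> ^ n) \<le> ln (exp (Re (g 0)))"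
        using n \<rho> by (subst ln_le_cancel_iff) auto
      then have "c + real n * ln \<rho> \<le> Re (g 0)"
        using n \<rho> by (simp add: c_def ln_mult ln_div ln_realpow)
      also have "\<dots> = circle_mean (\<lambda>z. Re (g z)) \<rho>"
        using circle_mean_Re_holomorphic[OF g(1) \<rho>] by simp
      also have "\<dots> \<le> circle_mean (\<lambda>z. B z + e) \<rho>"
        using g \<rho> by (intro circle_mean_mono cg continuous_intros B) auto
      also have "\<dots> = circle_mean B \<rho> + e"
        using \<rho> B by (subst circle_mean_add) (auto simp: circle_mean_const)
      finally show "c + real n * ln \<rho> \<le> circle_mean B \<rho> + e" .
    qed
  qed
qed

text \<open>For harmonic functions both means are the value at 0, because \<open>h 0 = 0\<close>.
  Harmonic majorants transfer this to continuous functions. It serves for rotations, the reflection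
  at 0 and the power map.\<close>

lemma circle_mean_comp:
  assumes u: "continuous_on (sphere 0 r) u" and r: "0 < r"
    and h: "h holomorphic_on UNIV" "h 0 = 0" "\<And>z. norm z = s \<Longrightarrow> norm (h z) = r" and s: "0 < s"
  shows "circle_mean (\<lambda>z. u (h z)) s = circle_mean u r"
proof -
  have hc: "continuous_on (sphere 0 s) h"
    using h(1) holomorphic_on_imp_continuous_on continuous_on_subset by blast
  have uh: "continuous_on (sphere 0 s) (\<lambda>z. v (h z))" if "continuous_on (sphere 0 r) v" for v :: "complex \<Rightarrow> real"
    by (rule continuous_on_compose2[OF that hc]) (use h in auto)
  have le: "circle_mean (\<lambda>z. v (h z)) s \<le> circle_mean v r" if v: "continuous_on (sphere 0 r) v" for v
  proof (rule field_le_epsilon)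
    fix e :: real assume e: "0 < e"
    obtain g where g: "g holomorphic_on UNIV" "\<And>z. norm z = r \<Longrightarrow> v z \<le> Re (g z)"
      "\<And>z. norm z = r \<Longrightarrow> Re (g z) \<le> v z + e"
      using harmonic_majorant_on_circle[OF v e] by blast
    have cg: "continuous_on (sphere 0 r) (\<lambda>z. Re (g z))"
      using g(1) holomorphic_on_imp_continuous_on
      by (intro continuous_intros) (meson continuous_on_subset subset_UNIV)
    have "circle_mean (\<lambda>z. v (h z)) s \<le> circle_mean (\<lambda>z. Re (g (h z))) s"
      using g h s by (intro circle_mean_mono uh v cg) auto
    also have "\<dots> = Re (g (h 0))"
      by (rule circle_mean_Re_holomorphic)
        (use holomorphic_on_compose_gen[OF h(1) g(1)] s in \<open>auto simp: o_def\<close>)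
    also have "\<dots> = circle_mean (\<lambda>z. Re (g z)) r"
      using h circle_mean_Re_holomorphic[OF g(1) r] by simp
    also have "\<dots> \<le> circle_mean (\<lambda>z. v z + e) r"
      using g r by (intro circle_mean_mono cg continuous_intros v) auto
    also have "\<dots> = circle_mean v r + e"
      using r v by (subst circle_mean_add) (auto simp: circle_mean_const)
    finally show "circle_mean (\<lambda>z. v (h z)) s \<le> circle_mean v r + e" .
  qed
  \<comment> \<open>The same inequality for \<open>- u\<close> is the reverse one for
    \<open>u\<close>.\<close>
  have "circle_mean (\<lambda>z. - 1 * u (h z)) s \<le> circle_mean (\<lambda>z. - 1 * u z) r"
    by (rule le) (intro continuous_intros u)
  then show ?thesis
    using le[OF u] unfolding circle_mean_cmult by simp
qed

subsection \<open>Cauchy's formula for the perimeter\<close>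

lemma circle_mean_abs_Re: "circle_mean (\<lambda>z. \<bar>Re z\<bar>) 1 = 2 / pi"
proof -
  have F: "((\<lambda>t. c * cos t) has_integral (c * sin b - c * sin a)) {a..b}" if "a \<le> b" for a b c :: real
    by (rule fundamental_theorem_of_calculus[OF that])
      (auto intro!: derivative_eq_intros simp flip: has_real_derivative_iff_has_vector_derivative)
  have 1: "((\<lambda>t. \<bar>cos t\<bar>) has_integral 1) {0..pi/2}"
  proof (rule has_integral_eq[OF _ F[of 0 "pi/2" 1, simplified]])
    fix t assume "t \<in> {0..pi/2}"
    then have "0 \<le> cos t" by (intro cos_ge_zero) auto
    then show "cos t = \<bar>cos t\<bar>" by simp
  qed
  have 2: "((\<lambda>t. \<bar>cos t\<bar>) has_integral 2) {pi/2..3*pi/2}"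
  proof (rule has_integral_eq)
    fix t assume t: "t \<in> {pi/2..3*pi/2}"
    then have "0 \<le> cos (t - pi)" by (intro cos_ge_zero) auto
    then show "- 1 * cos t = \<bar>cos t\<bar>" by simp
  next
    have "sin (3 * pi / 2) = - 1" by (metis sin_3over2_pi times_divide_eq_left)
    then show "((\<lambda>t. - 1 * cos t) has_integral 2) {pi/2..3*pi/2}"
      using F[of "pi/2" "3*pi/2" "-1"] by simp
  qed
  have 3: "((\<lambda>t. \<bar>cos t\<bar>) has_integral 1) {3*pi/2..2*pi}"
  proof (rule has_integral_eq)
    fix t assume t: "t \<in> {3*pi/2..2*pi}"
    then have "0 \<le> cos (t - 2 * pi)" by (intro cos_ge_zero) auto
    then show "1 * cos t = \<bar>cos t\<bar>" by (simp add: cos_diff)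
  next
    have "sin (3 * pi / 2) = - 1" by (metis sin_3over2_pi times_divide_eq_left)
    then show "((\<lambda>t. 1 * cos t) has_integral 1) {3*pi/2..2*pi}"
      using F[of "3*pi/2" "2*pi" 1] by simp
  qed
  have "((\<lambda>t. \<bar>cos t\<bar>) has_integral (1 + 2 + 1)) {0..2*pi}"
    by (rule has_integral_combine[OF _ _ has_integral_combine[OF _ _ 1 2] 3]) auto
  then show ?thesis
    unfolding circle_mean_def by (simp add: integral_unique)
qed

lemma circle_mean_abs_inner: "circle_mean (\<lambda>u. \<bar>d \<bullet> u\<bar>) 1 = 2 * norm d / pi"
proof -
  have d: "d = of_real (norm d) * cis (Arg d)"
    using rcis_cmod_Arg[of d] by (simp add: rcis_def)
  have eq: "\<bar>d \<bullet> (cis (Arg d) * z)\<bar> = norm d * \<bar>Re z\<bar>" for z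
  proof -
    have "d \<bullet> (cis (Arg d) * z) = Re (cnj d * (cis (Arg d) * z))"
      by (simp add: inner_complex_def)
    also have "cnj d * (cis (Arg d) * z) = of_real (norm d) * z"
      by (subst d) (simp add: cis_cnj mult.assoc[symmetric] cis_mult)
    finally show ?thesis by (simp add: abs_mult)
  qed
  have "circle_mean (\<lambda>u. \<bar>d \<bullet> u\<bar>) 1 = circle_mean (\<lambda>z. \<bar>d \<bullet> (cis (Arg d) * z)\<bar>) 1"
    by (rule circle_mean_comp[symmetric])
      (auto intro!: continuous_intros holomorphic_intros simp: norm_mult)
  also have "\<dots> = norm d * circle_mean (\<lambda>z. \<bar>Re z\<bar>) 1"
    unfolding eq by (rule circle_mean_cmult)
  finally show ?thesis by (simp add: circle_mean_abs_Re)
qed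

lemma continuous_on_Max_finite:
  fixes g :: "'i \<Rightarrow> 'a::topological_space \<Rightarrow> real"
  assumes "finite J" "J \<noteq> {}" "\<And>j. j \<in> J \<Longrightarrow> continuous_on S (g j)"
  shows "continuous_on S (\<lambda>z. Max ((\<lambda>j. g j z) ` J))"
  using assms
proof (induction J rule: finite_ne_induct)
  case (insert j J)
  then have "continuous_on S (\<lambda>z. max (g j z) (Max ((\<lambda>j. g j z) ` J)))"
    by (intro continuous_on_max) auto
  then show ?case using insert.hyps by simp
qed auto

section \<open>Edges of a convex polygon and the lines that cross it\<close>

lemma diameter_closed_segment:
  fixes a b :: "'a::euclidean_space"
  shows "diameter (closed_segment a b) = dist a b"
proof (rule antisym)
  show "diameter (closed_segment a b) \<le> dist a b"
  proof (rule diameter_le)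
    fix x y assume "x \<in> closed_segment a b" "y \<in> closed_segment a b"
    then obtain s t where s: "0 \<le> s" "s \<le> 1" "x = (1 - s) *\<^sub>R a + s *\<^sub>R b"
      and t: "0 \<le> t" "t \<le> 1" "y = (1 - t) *\<^sub>R a + t *\<^sub>R b"
      by (auto simp: in_segment)
    have "x - y = (t - s) *\<^sub>R (a - b)" unfolding s t by (simp add: algebra_simps)
    then have "norm (x - y) = \<bar>t - s\<bar> * dist a b" by (simp add: dist_norm)
    also have "\<dots> \<le> 1 * dist a b" using s t by (intro mult_right_mono) auto
    finally show "norm (x - y) \<le> dist a b" by simp
  qed auto
  show "dist a b \<le> diameter (closed_segment a b)"
    by (rule diameter_bounded_bound) (auto simp: bounded_closed_segment)
qed

text \<open>The intersection of two faces is a face. If it is smaller than one of the edges, its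
  dimension drops to 0, so it is a single point and therefore an extreme point.\<close>

lemma edges_meet_at_extreme_point:
  fixes K :: "'a::euclidean_space set"
  assumes "E edge_of K" "E' edge_of K" "x \<in> E" "x \<in> E'" "\<not> x extreme_point_of K"
  shows "E = E'"
proof -
  have "E \<inter> E' = F" if F: "F = E \<or> F = E'" for F
  proof (rule ccontr)
    assume ne: "E \<inter> E' \<noteq> F"
    have fK: "E \<inter> E' face_of K" using assms unfolding edge_of_def by (auto intro: face_of_Int)
    have FK: "F face_of K" "aff_dim F = 1" using F assms unfolding edge_of_def by auto
    then have "F \<subseteq> K" "convex F" by (auto simp: face_of_imp_subset face_of_imp_convex)
    moreover have "E \<inter> E' \<subseteq> F" using F by auto
    ultimately have "aff_dim (E \<inter> E') < aff_dim F"
      using fK ne by (meson face_of_aff_dim_lt face_of_subset)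
    moreover have "aff_dim (E \<inter> E') \<ge> 0" using assms by (metis IntI aff_dim_negative_iff empty_iff not_less)
    ultimately have "aff_dim (E \<inter> E') = 0" using FK by linarith
    then obtain a where "E \<inter> E' = {a}" by (auto simp: aff_dim_eq_0)
    then have "{x} face_of K" using fK assms by (metis IntI singletonD)
    then show False using assms by (simp add: face_of_singleton)
  qed
  then show ?thesis by metis
qed

text \<open>The line passes through an interior point \<open>c\<close> and leaves \<open>K\<close>
  at one frontier point in each direction. Neither point is a vertex, so each lies on exactly one
  edge. The two edges differ, because an edge containing both points would by convexity contain
  \<open>c\<close>.\<close>

lemma line_meets_two_edges:
  fixes K :: "complex set"
  assumes K: "polytope K" "aff_dim K = 2"
    and ab: "a \<in> K" "b \<in> K" "a \<bullet> u < t" "t < b \<bullet> u"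
    and ext: "\<And>x. x extreme_point_of K \<Longrightarrow> x \<bullet> u \<noteq> t"
  shows "card {E. E edge_of K \<and> t \<in> (\<lambda>x. x \<bullet> u) ` E} = 2"
proof -
  have cvx: "convex K" and clo: "closed K" and bou: "bounded K"
    using K by (auto simp: polytope_imp_convex polytope_imp_closed polytope_imp_bounded)
  have u: "u \<noteq> 0" using ab by auto
  have aff: "affine hull K = UNIV" using K aff_dim_eq_full[of K] by simp
  \<comment> \<open>In dimension 2 the facets are the edges, and the facets cover the
    frontier.\<close>
  have fr: "frontier K = \<Union>{E. E edge_of K}"
  proof -
    have "E facet_of K \<longleftrightarrow> E edge_of K" for E
      unfolding facet_of_def edge_of_def using K by auto
    then show ?thesis
      using rel_frontier_of_polyhedron[OF polytope_imp_polyhedron[OF K(1)]] rel_frontier_frontier[OF aff]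
      by simp
  qed
  have "interior K \<noteq> {}"
    using aff cvx ab rel_interior_eq_empty rel_interior_interior by fastforce
  then obtain i0 where i0: "i0 \<in> interior K" by auto
  \<comment> \<open>From \<open>i0\<close> one walks towards \<open>a\<close> or \<open>b\<close>,
    whichever lies across the line. The open segment from an interior point to a point of
    \<open>K\<close> is interior.\<close>
  obtain c where c: "c \<in> interior K" "c \<bullet> u = t"
  proof -
    have *: "\<exists>c \<in> interior K. c \<bullet> u = t" if b: "b \<in> K" "(t - i0 \<bullet> u) * (b \<bullet> u - t) > 0" for b
    proof -
      define s where "s = (t - i0 \<bullet> u) / (b \<bullet> u - i0 \<bullet> u)"
      have s: "0 < s" "s < 1" "b \<bullet> u - i0 \<bullet> u \<noteq> 0"
        using b(2) unfolding s_def zero_less_mult_iff by (auto simp: field_simps)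
      define c where "c = (1 - s) *\<^sub>R i0 + s *\<^sub>R b"
      have "c \<bullet> u = i0 \<bullet> u + s * (b \<bullet> u - i0 \<bullet> u)"
        unfolding c_def by (simp add: inner_add_left algebra_simps)
      also have "\<dots> = t" using s by (simp add: s_def)
      finally have cu: "c \<bullet> u = t" .
      have "i0 \<noteq> b" using s by auto
      then have "c \<in> open_segment i0 b" using s unfolding c_def in_segment by blast
      then have "c \<in> interior K"
        using in_interior_closure_convex_segment[OF cvx i0, of b] b closure_subset by blast
      then show ?thesis using cu by blast
    qed
    consider "i0 \<bullet> u = t" | "i0 \<bullet> u < t" | "t < i0 \<bullet> u" by linarith
    then have "\<exists>c \<in> interior K. c \<bullet> u = t"
    proof cases
      case 1 then show ?thesis using i0 by blast
    next
      case 2 then show ?thesis using ab by (intro *[of b]) auto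
    next
      case 3 then show ?thesis using ab by (intro *[of a] mult_neg_neg) auto
    qed
    then show thesis using that by blast
  qed
  \<comment> \<open>\<open>u\<close> turned by a right angle is the direction of the line.\<close>
  define n where "n = \<i> * u"
  have n: "n \<noteq> 0" "n \<bullet> u = 0" using u by (auto simp: n_def inner_complex_def)
  have line: "\<exists>e. z = c + e *\<^sub>R n" if "z \<bullet> u = t" for z
  proof -
    have 0: "Re (z - c) * Re u + Im (z - c) * Im u = 0"
      using that c by (simp add: inner_complex_def algebra_simps)
    have nu: "Re u * Re u + Im u * Im u \<noteq> 0"
      using u by (simp add: complex_eq_iff sum_squares_eq_zero_iff)
    define e where "e = (Im (z - c) * Re u - Re (z - c) * Im u) / (Re u * Re u + Im u * Im u)"
    have "Re (z - c) * (Re u * Re u + Im u * Im u) = - (Im (z - c) * Re u - Re (z - c) * Im u) * Im u"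
      using 0 by algebra
    moreover have "Im (z - c) * (Re u * Re u + Im u * Im u) = (Im (z - c) * Re u - Re (z - c) * Im u) * Re u"
      using 0 by algebra
    ultimately have "Re (z - c) = - e * Im u" "Im (z - c) = e * Re u"
      using nu by (auto simp: e_def field_simps)
    then have "z - c = e *\<^sub>R n" by (simp add: n_def complex_eq_iff)
    then show ?thesis by (metis add_diff_cancel_left' diff_add_cancel add.commute)
  qed
  have ray: "\<exists>d>0. c + d *\<^sub>R l \<in> frontier K \<and> (\<forall>e\<ge>0. c + e *\<^sub>R l \<in> frontier K \<longrightarrow> e = d)"
    if l: "l \<noteq> 0" for l
  proof -
    obtain d where d: "0 < d" "c + d *\<^sub>R l \<in> frontier K"
      "\<And>e. \<lbrakk>0 \<le> e; e < d\<rbrakk> \<Longrightarrow> c + e *\<^sub>R l \<in> interior K"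
      using ray_to_frontier[OF bou c(1) l] by metis
    \<comment> \<open>A frontier point further out would put the first one on an open segment
      starting at \<open>c\<close>, hence in the interior.\<close>
    have "e = d" if e: "0 \<le> e" "c + e *\<^sub>R l \<in> frontier K" for e
    proof (rule ccontr)
      assume "e \<noteq> d"
      then have "d < e" using d(3)[of e] e by (force simp: frontier_def)
      moreover have "c + d *\<^sub>R l = (1 - d / e) *\<^sub>R c + (d / e) *\<^sub>R (c + e *\<^sub>R l)"
        using \<open>d < e\<close> d(1) by (simp add: algebra_simps)
      moreover have "c \<noteq> c + e *\<^sub>R l" using l \<open>d < e\<close> d(1) by simp
      ultimately have "c + d *\<^sub>R l \<in> open_segment c (c + e *\<^sub>R l)"
        using d(1) unfolding in_segment by (intro conjI exI[of _ "d / e"]) auto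
      then have "c + d *\<^sub>R l \<in> interior K"
        using in_interior_closure_convex_segment[OF cvx c(1), of "c + e *\<^sub>R l"] e(2)
        by (auto simp: frontier_def)
      then show False using d(2) by (simp add: frontier_def)
    qed
    then show ?thesis using d by blast
  qed
  obtain d1 where d1: "0 < d1" "c + d1 *\<^sub>R n \<in> frontier K"
    "\<And>e. \<lbrakk>0 \<le> e; c + e *\<^sub>R n \<in> frontier K\<rbrakk> \<Longrightarrow> e = d1"
    using ray[OF n(1)] by blast
  obtain d2 where d2: "0 < d2" "c + d2 *\<^sub>R (- n) \<in> frontier K"
    "\<And>e. \<lbrakk>0 \<le> e; c + e *\<^sub>R (- n) \<in> frontier K\<rbrakk> \<Longrightarrow> e = d2"
    using ray[of "- n"] n(1) by auto
  define x y where "x = c + d1 *\<^sub>R n" and "y = c + d2 *\<^sub>R (- n)"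
  have xu: "x \<bullet> u = t" and yu: "y \<bullet> u = t"
    using c n by (simp_all add: x_def y_def inner_diff_left inner_add_left)
  have only: "z = x \<or> z = y" if z: "z \<in> frontier K" "z \<bullet> u = t" for z
  proof -
    obtain e where e: "z = c + e *\<^sub>R n" using line[OF z(2)] by blast
    show ?thesis
    proof (cases "0 \<le> e")
      case True
      then show ?thesis using d1(3)[of e] z e by (simp add: x_def)
    next
      case False
      then show ?thesis using d2(3)[of "- e"] z e by (auto simp: y_def)
    qed
  qed
  obtain Ex where Ex: "Ex edge_of K" "x \<in> Ex" using d1(2) fr x_def by blast
  obtain Ey where Ey: "Ey edge_of K" "y \<in> Ey" using d2(2) fr y_def by blast
  have "Ex \<noteq> Ey"
  proof
    assume eq: "Ex = Ey"
    have cx: "convex Ex" using Ex face_of_imp_convex edge_of_def by blast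
    \<comment> \<open>The parameter at which the segment from \<open>x\<close> to \<open>y\<close>
      passes through \<open>c\<close>.\<close>
    define s where "s = d1 / (d1 + d2)"
    have s: "0 \<le> s" "s \<le> 1" using d1 d2 by (auto simp: s_def)
    have "(1 - s) * d1 = s * d2" using d1(1) d2(1) by (simp add: s_def field_simps)
    moreover have "(1 - s) *\<^sub>R x + s *\<^sub>R y = c + ((1 - s) * d1 - s * d2) *\<^sub>R n"
      unfolding x_def y_def by (simp add: algebra_simps)
    ultimately have "(1 - s) *\<^sub>R x + s *\<^sub>R y = c" by simp
    then have "c \<in> Ex"
      using convexD_alt[OF cx Ex(2), of y s] Ey eq s by simp
    then have "c \<in> frontier K" using fr Ex by blast
    then show False using c by (simp add: frontier_def)
  qed
  moreover have "{E. E edge_of K \<and> t \<in> (\<lambda>x. x \<bullet> u) ` E} = {Ex, Ey}"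
  proof (intro equalityI subsetI)
    fix E assume "E \<in> {E. E edge_of K \<and> t \<in> (\<lambda>x. x \<bullet> u) ` E}"
    then obtain z where E: "E edge_of K" "z \<in> E" "z \<bullet> u = t" by auto
    then have "z \<in> frontier K" using fr by blast
    then have "z = x \<or> z = y" using only E by blast
    moreover have "\<not> x extreme_point_of K" "\<not> y extreme_point_of K" using ext xu yu by blast+
    ultimately show "E \<in> {Ex, Ey}"
      using edges_meet_at_extreme_point E Ex Ey by blast
  next
    fix E assume "E \<in> {Ex, Ey}"
    moreover have "t \<in> (\<lambda>x. x \<bullet> u) ` Ex" using Ex xu by (intro image_eqI[of _ _ x]) auto
    moreover have "t \<in> (\<lambda>x. x \<bullet> u) ` Ey" using Ey yu by (intro image_eqI[of _ _ y]) auto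
    ultimately show "E \<in> {E. E edge_of K \<and> t \<in> (\<lambda>x. x \<bullet> u) ` E}"
      using Ex Ey by auto
  qed
  ultimately show ?thesis by simp
qed

lemma edge_of_polytope_segment:
  fixes K :: "'a::euclidean_space set"
  assumes "polytope K" "E edge_of K"
  shows "\<exists>a b. E = closed_segment a b"
proof -
  have "polytope E" "aff_dim E = 1"
    using assms face_of_polytope_polytope unfolding edge_of_def by auto
  then have "compact E" "convex E" "collinear E" "E \<noteq> {}"
    by (auto simp: polytope_imp_compact polytope_imp_convex collinear_aff_dim)
  then show ?thesis by (metis compact_convex_collinear_segment)
qed

lemma indicator_inner_segment_has_integral:
  fixes a b u :: "'a::euclidean_space"
  shows "(indicat_real ((\<lambda>x. x \<bullet> u) ` closed_segment a b) has_integral \<bar>(b - a) \<bullet> u\<bar>) UNIV"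
proof -
  have "(\<lambda>x. x \<bullet> u) ` closed_segment a b = closed_segment (a \<bullet> u) (b \<bullet> u)"
    by (rule closed_segment_linear_image[symmetric]) (rule bounded_linear.linear, rule bounded_linear_inner_left)
  also have "\<dots> = {min (a \<bullet> u) (b \<bullet> u)..max (a \<bullet> u) (b \<bullet> u)}"
    by (auto simp: closed_segment_eq_real_ivl)
  finally have "(\<lambda>x. x \<bullet> u) ` closed_segment a b = {min (a \<bullet> u) (b \<bullet> u)..max (a \<bullet> u) (b \<bullet> u)}" .
  moreover have "(indicat_real {c..d} has_integral (d - c)) UNIV" if "c \<le> d" for c d :: real
  proof -
    have "((\<lambda>x. if x \<in> {c..d} then 1 else 0) has_integral (d - c)) UNIV"
      using has_integral_const_real[of "1::real" c d] that
      by (subst has_integral_restrict_UNIV) simp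
    moreover have "indicat_real {c..d} = (\<lambda>x. if x \<in> {c..d} then 1 else 0)"
      by (auto simp: indicator_def)
    ultimately show ?thesis by simp
  qed
  moreover have "max (a \<bullet> u) (b \<bullet> u) - min (a \<bullet> u) (b \<bullet> u) = \<bar>(b - a) \<bullet> u\<bar>"
    by (simp add: inner_diff_left abs_if max_def min_def)
  ultimately show ?thesis by (metis min.coboundedI1 max.coboundedI1 min_le_iff_disj order_refl le_max_iff_disj)
qed

section \<open>Support functions, widths and the perimeter\<close>

definition support :: "'a::euclidean_space set \<Rightarrow> 'a \<Rightarrow> real" where
  "support X u = Max ((\<lambda>x. x \<bullet> u) ` X)"

lemma support_mono_point: "finite X \<Longrightarrow> x \<in> X \<Longrightarrow> x \<bullet> u \<le> support X u"
  unfolding support_def by simp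

lemma support_attained:
  assumes "finite X" "X \<noteq> {}"
  obtains x where "x \<in> X" "support X u = x \<bullet> u"
proof -
  have "support X u \<in> (\<lambda>x. x \<bullet> u) ` X"
    unfolding support_def using assms by (intro Max_in) auto
  then show thesis using that by blast
qed

lemma continuous_on_support:
  assumes "finite X" "X \<noteq> {}"
  shows "continuous_on S (support X)"
  unfolding support_def using assms by (intro continuous_on_Max_finite) (auto intro!: continuous_intros)

lemma support_scale:
  assumes X: "finite X" "X \<noteq> {}" and c: "0 \<le> c"
  shows "support X (c *\<^sub>R u) = c * support X u"
proof (rule antisym)
  obtain x where "x \<in> X" "support X (c *\<^sub>R u) = x \<bullet> (c *\<^sub>R u)"
    by (rule support_attained[OF X])
  then show "support X (c *\<^sub>R u) \<le> c * support X u"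
    using c support_mono_point[OF X(1), of x u] by (simp add: mult_left_mono)
  obtain x where "x \<in> X" "support X u = x \<bullet> u"
    by (rule support_attained[OF X])
  then show "c * support X u \<le> support X (c *\<^sub>R u)"
    using support_mono_point[OF X(1), of x "c *\<^sub>R u"] by simp
qed

text \<open>A half-space containing \<open>X\<close> contains its hull, so the finite maximum is the
  support function of the hull.\<close>

lemma support_hull:
  assumes "finite X" "X \<noteq> {}"
  shows "x \<in> convex hull X \<Longrightarrow> x \<bullet> u \<le> support X u" "\<exists>x \<in> convex hull X. x \<bullet> u = support X u"
proof -
  have "convex hull X \<subseteq> {x. u \<bullet> x \<le> support X u}"
  proof (rule hull_minimal)
    show "convex {x. u \<bullet> x \<le> support X u}" by (rule convex_halfspace_le)
    show "X \<subseteq> {x. u \<bullet> x \<le> support X u}"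
      by (auto simp: inner_commute intro: support_mono_point assms)
  qed
  then show "x \<in> convex hull X \<Longrightarrow> x \<bullet> u \<le> support X u" by (auto simp: inner_commute)
  obtain x where "x \<in> X" "support X u = x \<bullet> u"
    by (rule support_attained[OF assms])
  then show "\<exists>x \<in> convex hull X. x \<bullet> u = support X u"
    using hull_subset[of X convex] by auto
qed

text \<open>Both sides integrate over \<open>t\<close> the number of edges met by the line
  \<open>x \<bullet> u = t\<close>. Edge by edge this gives the lengths of the projections. Line by
  line it gives 2 between the two supporting lines and 0 outside, up to finitely many
  \<open>t\<close>.\<close>

lemma width_eq_sum_edges:
  fixes X :: "complex set"
  assumes X: "finite X" "X \<noteq> {}" and dim: "aff_dim (convex hull X) = 2"
    and ab: "\<And>E. E edge_of (convex hull X) \<Longrightarrow> E = closed_segment (a E) (b E)"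
  shows "2 * (support X u + support X (- u)) = (\<Sum>E | E edge_of (convex hull X). \<bar>(b E - a E) \<bullet> u\<bar>)"
proof (cases "u = 0")
  case True
  then show ?thesis using X by (simp add: support_def)
next
  case False
  define K where "K = convex hull X"
  have K: "polytope K" using X by (simp add: K_def polytope_convex_hull)
  have fin: "finite {E. E edge_of K}"
    using finite_polytope_faces[OF K] unfolding edge_of_def by (rule rev_finite_subset) auto
  have ub: "x \<bullet> u \<le> support X u" "- support X (- u) \<le> x \<bullet> u" if "x \<in> K" for x
    using support_hull(1)[OF X, of x u] support_hull(1)[OF X, of x "- u"] that
    by (auto simp: K_def)
  obtain x1 where x1: "x1 \<in> K" "x1 \<bullet> u = support X u"
    using support_hull(2)[OF X, of u] K_def by blast
  obtain x2 where x2: "x2 \<in> K" "x2 \<bullet> u = - support X (- u)"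
    using support_hull(2)[OF X, of "- u"] K_def by force
  \<comment> \<open>The lines through a vertex and the two supporting lines are excluded; being
    finitely many, they do not affect the integral.\<close>
  define T where "T = (\<lambda>x. x \<bullet> u) ` {x. x extreme_point_of K} \<union> {x1 \<bullet> u, x2 \<bullet> u}"
  have "finite {x. x extreme_point_of K}"
    using extreme_points_of_convex_hull[of X] X finite_subset K_def by blast
  then have T: "finite T" by (simp add: T_def)
  have "((\<lambda>t. \<Sum>E | E edge_of K. indicat_real ((\<lambda>x. x \<bullet> u) ` E) t) has_integral
      (\<Sum>E | E edge_of K. \<bar>(b E - a E) \<bullet> u\<bar>)) UNIV"
  proof (rule has_integral_sum[OF fin])
    fix E assume "E \<in> {E. E edge_of K}"
    then have "E = closed_segment (a E) (b E)" using ab K_def by simp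
    then show "(indicat_real ((\<lambda>x. x \<bullet> u) ` E) has_integral \<bar>(b E - a E) \<bullet> u\<bar>) UNIV"
      using indicator_inner_segment_has_integral[of u "a E" "b E"] by simp
  qed
  then have "((\<lambda>t. 2 * indicat_real ((\<lambda>x. x \<bullet> u) ` closed_segment x2 x1) t) has_integral
      (\<Sum>E | E edge_of K. \<bar>(b E - a E) \<bullet> u\<bar>)) UNIV"
  proof (rule has_integral_spike_finite[OF T, rotated])
    fix t assume t: "t \<in> UNIV - T"
    have im: "(\<lambda>x. x \<bullet> u) ` closed_segment x2 x1 = {x2 \<bullet> u..x1 \<bullet> u}"
    proof -
      have "(\<lambda>x. x \<bullet> u) ` closed_segment x2 x1 = closed_segment (x2 \<bullet> u) (x1 \<bullet> u)"
        by (rule closed_segment_linear_image[symmetric]) (rule bounded_linear.linear, rule bounded_linear_inner_left)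
      moreover have "x2 \<bullet> u \<le> x1 \<bullet> u" using ub(1)[OF x2(1)] x1 by simp
      ultimately show ?thesis by (simp add: closed_segment_eq_real_ivl)
    qed
    have "(\<Sum>E | E edge_of K. indicat_real ((\<lambda>x. x \<bullet> u) ` E) t)
        = real (card {E. E edge_of K \<and> t \<in> (\<lambda>x. x \<bullet> u) ` E})"
      using fin by (simp add: indicator_def sum.If_cases Collect_conj_eq of_bool_def)
    also have "\<dots> = 2 * indicat_real {x2 \<bullet> u..x1 \<bullet> u} t"
    proof (cases "x2 \<bullet> u < t \<and> t < x1 \<bullet> u")
      case True
      have "card {E. E edge_of K \<and> t \<in> (\<lambda>x. x \<bullet> u) ` E} = 2"
        by (rule line_meets_two_edges[OF K _ x2(1) x1(1)])
          (use True t dim in \<open>auto simp: T_def K_def\<close>)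
      then show ?thesis using True by simp
    next
      case False
      moreover have "t \<noteq> x2 \<bullet> u" "t \<noteq> x1 \<bullet> u" using t by (auto simp: T_def)
      ultimately have out: "t < x2 \<bullet> u \<or> x1 \<bullet> u < t" by linarith
      have "{E. E edge_of K \<and> t \<in> (\<lambda>x. x \<bullet> u) ` E} = {}"
        using out ub x1 x2 edge_of_imp_subset by (fastforce dest: subsetD)
      then show ?thesis using out by (simp only: card.empty) auto
    qed
    finally show "2 * indicat_real ((\<lambda>x. x \<bullet> u) ` closed_segment x2 x1) t
        = (\<Sum>E | E edge_of K. indicat_real ((\<lambda>x. x \<bullet> u) ` E) t)"
      unfolding im by simp
  qed
  moreover have "((\<lambda>t. 2 * indicat_real ((\<lambda>x. x \<bullet> u) ` closed_segment x2 x1) t) has_integral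
      2 * \<bar>(x1 - x2) \<bullet> u\<bar>) UNIV"
    by (intro has_integral_mult_right indicator_inner_segment_has_integral)
  ultimately have "2 * \<bar>(x1 - x2) \<bullet> u\<bar> = (\<Sum>E | E edge_of K. \<bar>(b E - a E) \<bullet> u\<bar>)"
    by (rule has_integral_unique[rotated])
  moreover have "\<bar>(x1 - x2) \<bullet> u\<bar> = support X u + support X (- u)"
    using x1 x2 ub(1)[OF x2(1)] by (simp add: inner_diff_left)
  ultimately show ?thesis by (simp add: K_def)
qed

text \<open>The width is averaged over all directions. By reflection its mean is twice that of
  \<open>support X\<close>, and an edge vector \<open>d\<close> contributes the mean of
  \<open>\<bar>d \<bullet> u\<bar>\<close>, which is proportional to its length.\<close>

lemma Cauchy_perimeter_formula:
  assumes X: "finite X" "X \<noteq> {}"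
  shows "circle_mean (support X) 1 = circumference (convex hull X) / (2 * pi)"
proof -
  have cs: "continuous_on S (support X)" for S
    by (rule continuous_on_support[OF X])
  have cs': "continuous_on S (\<lambda>u. support X (- u))" for S
    by (rule continuous_on_compose2[OF cs[of UNIV]]) (auto intro!: continuous_intros)
  have "circle_mean (\<lambda>u. support X (- u)) 1 = circle_mean (support X) 1"
    by (rule circle_mean_comp) (auto intro!: cs holomorphic_intros)
  then have two: "2 * circle_mean (support X) 1 = circle_mean (\<lambda>u. support X u + support X (- u)) 1"
    by (subst circle_mean_add) (auto intro!: cs cs')
  define K where "K = convex hull X"
  have K: "polytope K" using X by (simp add: K_def polytope_convex_hull)
  show ?thesis
  proof (cases "aff_dim K = 2")
    case True
    have "\<exists>a b. \<forall>E. E edge_of K \<longrightarrow> E = closed_segment (a E) (b E)"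
      using edge_of_polytope_segment[OF K] by metis
    then obtain a b where ab: "\<And>E. E edge_of K \<Longrightarrow> E = closed_segment (a E) (b E)" by blast
    have fin: "finite {E. E edge_of K}"
      using finite_polytope_faces[OF K] unfolding edge_of_def by (rule rev_finite_subset) auto
    have sum: "circle_mean (\<lambda>u. \<Sum>E\<in>F. \<bar>(b E - a E) \<bullet> u\<bar>) 1 = (\<Sum>E\<in>F. 2 * norm (b E - a E) / pi)"
      if "finite F" for F
      using that
    proof induction
      case empty show ?case by (simp add: circle_mean_const)
    next
      case (insert E F)
      then show ?case
        by (simp add: circle_mean_add[where r = 1] continuous_intros circle_mean_abs_inner)
    qed
    \<comment> \<open>One factor 2 comes from the two support functions in the width, the other from
      the two edges met by each line.\<close>
    have "4 * circle_mean (support X) 1 = circle_mean (\<lambda>u. 2 * (support X u + support X (- u))) 1"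
      using two by (subst circle_mean_cmult) simp
    also have "\<dots> = (\<Sum>E | E edge_of K. 2 * norm (b E - a E) / pi)"
      using width_eq_sum_edges[OF X, of a b] True ab sum[OF fin] by (simp add: K_def)
    also have "\<dots> = (\<Sum>E | E edge_of K. 2 / pi * diameter E)"
    proof (rule sum.cong[OF refl])
      fix E assume "E \<in> {E. E edge_of K}"
      then have "diameter E = dist (a E) (b E)" using ab diameter_closed_segment by (metis mem_Collect_eq)
      then show "2 * norm (b E - a E) / pi = 2 / pi * diameter E"
        by (simp add: dist_norm norm_minus_commute)
    qed
    also have "\<dots> = 2 / pi * circumference K"
      using True by (simp add: circumference_def sum_distrib_left)
    finally show ?thesis by (simp add: K_def field_simps)
  next
    case False
    \<comment> \<open>The hull is a segment, possibly a point. Its width is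
      \<open>\<bar>(b - a) \<bullet> u\<bar>\<close>, and \<open>circumference\<close> counts its
      length twice.\<close>
    then have "aff_dim K \<le> 1" using aff_dim_le_DIM[of K] by simp
    moreover have "K \<noteq> {}" using X by (simp add: K_def)
    ultimately obtain a b where ab: "K = closed_segment a b"
      using K compact_convex_collinear_segment[of K]
      by (metis collinear_aff_dim polytope_imp_compact polytope_imp_convex)
    have s: "support X u = max (a \<bullet> u) (b \<bullet> u)" for u
    proof (rule antisym)
      obtain x where "x \<in> closed_segment a b" "x \<bullet> u = support X u"
        using support_hull(2)[OF X, of u] ab K_def by auto
      moreover have "closed_segment a b \<subseteq> {x. u \<bullet> x \<le> max (a \<bullet> u) (b \<bullet> u)}"
        by (rule closed_segment_subset[OF _ _ convex_halfspace_le]) (auto simp: inner_commute)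
      ultimately show "support X u \<le> max (a \<bullet> u) (b \<bullet> u)" by (auto simp: inner_commute)
      show "max (a \<bullet> u) (b \<bullet> u) \<le> support X u"
        using support_hull(1)[OF X, of _ u] ab by (auto simp: K_def)
    qed
    have "support X u + support X (- u) = \<bar>(b - a) \<bullet> u\<bar>" for u
      unfolding s by (simp add: inner_diff_left max_def abs_if)
    then have "2 * circle_mean (support X) 1 = 2 * norm (b - a) / pi"
      using two circle_mean_abs_inner[of "b - a"] by simp
    moreover have "circumference K = 2 * norm (b - a)"
      using False by (simp add: circumference_def ab diameter_closed_segment dist_norm norm_minus_commute)
    ultimately show ?thesis by (simp add: K_def)
  qed
qed

subsection \<open>Growth and elimination\<close>

definition weight :: "nat \<Rightarrow> real \<Rightarrow> real" where
  "weight k t = t ^ k + ln (2 + t)"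

text \<open>The class from which coefficients are taken. The logarithm in the weight admits
  polynomials even for \<open>k = 0\<close>, and the class is closed under sums, products and
  derivatives.\<close>

definition growth :: "nat \<Rightarrow> (complex \<Rightarrow> complex) \<Rightarrow> bool" where
  "growth k h \<longleftrightarrow> h holomorphic_on UNIV \<and> (\<exists>C. \<forall>z. norm (h z) \<le> exp (C * weight k (norm z)))"

text \<open>The 2 inside the logarithm keeps the weight away from 0 on the whole half-line, so that
  constant factors can be absorbed into \<open>exp (C * weight k t)\<close>.\<close>

lemma weight_ge: "1 / 2 \<le> weight k t" if "0 \<le> t"
proof -
  have "ln 2 \<le> ln (2 + t)" using that by simp
  moreover have "0 \<le> t ^ k" using that by simp
  ultimately show ?thesis unfolding weight_def using ln2_ge_two_thirds by linarith
qed

lemma weight_nonneg: "0 \<le> weight k t" if "0 \<le> t"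
  using weight_ge[OF that, of k] by simp

lemma weight_mono: "weight k s \<le> weight k t" if "0 \<le> s" "s \<le> t"
  unfolding weight_def using that by (intro add_mono power_mono) auto

text \<open>For Cauchy's estimates on discs of radius at most 1, where the weight may change by a
  constant factor only.\<close>

lemma weight_shift: "weight k (t + 1) \<le> (2 ^ (k + 1) + 2 ^ k + 2) * weight k t" if t: "0 \<le> t"
proof -
  have "(t + 1) ^ k \<le> (2 * max t 1) ^ k"
    using t by (intro power_mono) auto
  also have "\<dots> = 2 ^ k * max t 1 ^ k" by (simp add: power_mult_distrib)
  also have "\<dots> \<le> 2 ^ k * (t ^ k + 1)"
    using t by (intro mult_left_mono) (auto simp: max_def)
  also have "\<dots> \<le> 2 ^ k * (weight k t + 2 * weight k t)"
    using weight_ge[OF t, of k] t by (intro mult_left_mono add_mono) (auto simp: weight_def)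
  finally have 1: "(t + 1) ^ k \<le> (2 ^ (k + 1) + 2 ^ k) * weight k t"
    by (simp add: algebra_simps)
  have "ln (2 + (t + 1)) \<le> ln (2 * (2 + t))" using t by simp
  also have "\<dots> = ln 2 + ln (2 + t)" using t by (subst ln_mult) auto
  also have "\<dots> \<le> ln (2 + t) + ln (2 + t)" using t by simp
  also have "\<dots> \<le> 2 * weight k t" using t by (simp add: weight_def)
  finally show ?thesis using 1 unfolding weight_def[of k "t + 1"] distrib_right by simp
qed

lemma growthE:
  assumes "growth k h"
  obtains C where "0 \<le> C" "\<And>z. norm (h z) \<le> exp (C * weight k (norm z))"
proof -
  obtain C where C: "\<And>z. norm (h z) \<le> exp (C * weight k (norm z))"
    using assms unfolding growth_def by blast
  show thesis
  proof (rule that[of "max C 0"])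
    show "norm (h z) \<le> exp (max C 0 * weight k (norm z))" for z
      by (rule order_trans[OF C[of z]]) (auto intro!: mult_right_mono weight_nonneg)
  qed auto
qed

lemma growth_holomorphic: "growth k h \<Longrightarrow> h holomorphic_on UNIV"
  unfolding growth_def by blast

lemma growth_const: "growth k (\<lambda>_. c)"
proof -
  have "norm c \<le> exp (2 * ln (norm c + 1) * weight k (norm z))" for z :: complex
  proof -
    have "0 < norm c + 1" by (simp add: add_nonneg_pos)
    then have "norm c \<le> exp (2 * ln (norm c + 1) * (1 / 2))" by (simp add: exp_ln)
    also have "\<dots> \<le> exp (2 * ln (norm c + 1) * weight k (norm z))"
      using weight_ge[of "norm z" k] unfolding exp_le_cancel_iff by (intro mult_left_mono) auto
    finally show ?thesis .
  qed
  then show ?thesis unfolding growth_def by (auto intro!: holomorphic_intros)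
qed

lemma growth_ident: "growth k (\<lambda>z. z)"
proof -
  have "norm z \<le> exp (1 * weight k (norm z))" for z :: complex
  proof -
    have "0 < 2 + norm z" by (simp add: add_pos_nonneg)
    then have "norm z \<le> exp (ln (2 + norm z))" by (simp add: exp_ln)
    also have "\<dots> \<le> exp (1 * weight k (norm z))"
      unfolding weight_def by simp
    finally show ?thesis .
  qed
  then show ?thesis unfolding growth_def by (blast intro: holomorphic_on_ident)
qed

lemma growth_mult:
  assumes "growth k g" "growth k h"
  shows "growth k (\<lambda>z. g z * h z)"
proof -
  obtain C where C: "\<And>z. norm (g z) \<le> exp (C * weight k (norm z))"
    using assms unfolding growth_def by blast
  obtain D where D: "\<And>z. norm (h z) \<le> exp (D * weight k (norm z))"
    using assms unfolding growth_def by blast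
  have "norm (g z * h z) \<le> exp ((C + D) * weight k (norm z))" for z
    unfolding norm_mult distrib_right exp_add by (intro mult_mono C D) auto
  then show ?thesis
    using assms unfolding growth_def by (auto intro!: holomorphic_intros)
qed

lemma growth_add:
  assumes "growth k g" "growth k h"
  shows "growth k (\<lambda>z. g z + h z)"
proof -
  obtain C where C: "0 \<le> C" "\<And>z. norm (g z) \<le> exp (C * weight k (norm z))"
    by (rule growthE[OF assms(1)]) blast
  obtain D where D: "0 \<le> D" "\<And>z. norm (h z) \<le> exp (D * weight k (norm z))"
    by (rule growthE[OF assms(2)]) blast
  have "norm (g z + h z) \<le> exp ((C + D + 2) * weight k (norm z))" for z
  proof -
    let ?w = "weight k (norm z)"
    have w: "1 / 2 \<le> ?w" by (rule weight_ge) auto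
    have "norm (g z + h z) \<le> exp (C * ?w) + exp (D * ?w)"
      by (rule norm_triangle_le) (intro add_mono C D)
    also have "\<dots> \<le> exp ((C + D) * ?w) + exp ((C + D) * ?w)"
      unfolding exp_le_cancel_iff using C(1) D(1) w by (intro add_mono) (auto simp: distrib_right)
    also have "\<dots> = 2 * exp ((C + D) * ?w)" by simp
    also have "\<dots> \<le> exp (2 * ?w) * exp ((C + D) * ?w)"
      using w exp_ge_add_one_self[of "2 * ?w"] by (intro mult_right_mono) (linarith, simp)
    also have "\<dots> = exp ((C + D + 2) * ?w)" by (simp add: distrib_right flip: exp_add)
    finally show ?thesis .
  qed
  then show ?thesis
    using assms unfolding growth_def by (auto intro!: holomorphic_intros)
qed

lemma growth_sum: "(\<And>i. i \<in> I \<Longrightarrow> growth k (h i)) \<Longrightarrow> growth k (\<lambda>z. \<Sum>i\<in>I. h i z)"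
  by (induction I rule: infinite_finite_induct) (auto intro: growth_add growth_const)

lemma growth_diff: "growth k g \<Longrightarrow> growth k h \<Longrightarrow> growth k (\<lambda>z. g z - h z)"
  using growth_add[OF _ growth_mult[OF growth_const[of k "- 1"]], of g h] by simp

lemma growth_power: "growth k (\<lambda>z. z ^ n)"
  by (induction n) (auto intro: growth_const growth_mult growth_ident)

lemma growth_poly: "growth k (poly P)"
proof -
  have "growth k (\<lambda>z. \<Sum>i\<le>degree P. coeff P i * z ^ i)"
    by (intro growth_sum growth_mult growth_const growth_power)
  then show ?thesis by (simp flip: poly_altdef)
qed

lemma growth_exp_poly:
  assumes "degree Q \<le> k"
  shows "growth k (\<lambda>z. exp (poly Q z))"
proof -
  \<comment> \<open>The 3 arises because \<open>norm z ^ i\<close> is at most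
    \<open>1 + norm z ^ k\<close>, and 1 is at most twice the weight.\<close>
  define C where "C = (\<Sum>i\<le>degree Q. norm (coeff Q i) * 3)"
  have "norm (exp (poly Q z)) \<le> exp (C * weight k (norm z))" for z
  proof -
    have "Re (poly Q z) \<le> norm (poly Q z)" by (rule complex_Re_le_cmod)
    also have "\<dots> \<le> (\<Sum>i\<le>degree Q. norm (coeff Q i) * norm z ^ i)"
      unfolding poly_altdef by (rule order_trans[OF norm_sum]) (simp add: norm_mult norm_power)
    also have "\<dots> \<le> (\<Sum>i\<le>degree Q. norm (coeff Q i) * 3 * weight k (norm z))"
      unfolding mult.assoc
    proof (intro sum_mono mult_left_mono)
      fix i assume "i \<in> {..degree Q}"
      then have "i \<le> k" using assms by simp
      have "norm z ^ i \<le> 1 + norm z ^ k"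
      proof (cases "norm z \<le> 1")
        case True
        then have "norm z ^ i \<le> 1" by (intro power_le_one) auto
        then show ?thesis by (simp add: add_increasing2)
      next
        case False
        then have "norm z ^ i \<le> norm z ^ k" using \<open>i \<le> k\<close> by (intro power_increasing) auto
        then show ?thesis by simp
      qed
      also have "\<dots> \<le> 2 * weight k (norm z) + weight k (norm z)"
        using weight_ge[of "norm z" k] by (intro add_mono) (auto simp: weight_def)
      finally show "norm z ^ i \<le> 3 * weight k (norm z)" by simp
    qed auto
    also have "\<dots> = C * weight k (norm z)" by (simp add: C_def sum_distrib_right)
    finally show ?thesis by simp
  qed
  then show ?thesis unfolding growth_def by (auto intro!: holomorphic_intros)
qed

lemma exp_poly_of_order_growth:
  assumes "exp_poly_of_order d h" "d \<le> k"
  shows "growth k h"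
proof -
  obtain n P Q where h: "\<And>z. h z = (\<Sum>j\<le>(n::nat). poly (P j) z * exp (poly (Q j) z))"
    and d: "d = Max ((\<lambda>j. degree (Q j :: complex poly)) ` {..n})"
    using assms(1) unfolding exp_poly_of_order_def by blast
  have "degree (Q j) \<le> k" if "j \<le> n" for j
    using that assms(2) Max_ge[of "(\<lambda>j. degree (Q j)) ` {..n}" "degree (Q j)"] d by force
  then have "growth k (\<lambda>z. \<Sum>j\<le>n. poly (P j) z * exp (poly (Q j) z))"
    by (intro growth_sum growth_mult growth_poly growth_exp_poly) auto
  moreover have "h = (\<lambda>z. \<Sum>j\<le>n. poly (P j) z * exp (poly (Q j) z))" using h by blast
  ultimately show ?thesis by simp
qed

lemma growth_deriv:
  assumes "growth k h"
  shows "growth k (deriv h)"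
proof -
  obtain C where C: "0 \<le> C" "\<And>z. norm (h z) \<le> exp (C * weight k (norm z))"
    by (rule growthE[OF assms]) blast
  have hol: "h holomorphic_on S" for S
    using growth_holomorphic[OF assms] holomorphic_on_subset by blast
  define D where "D = (2 ^ (k + 1) + 2 ^ k + 2 :: real)"
  have "norm (deriv h z) \<le> exp (C * D * weight k (norm z))" for z
  proof -
    have "norm ((deriv ^^ 1) h z) \<le> fact 1 * exp (C * D * weight k (norm z)) / 1 ^ 1"
    proof (rule Cauchy_inequality)
      fix x assume x: "norm (z - x) = 1"
      have "norm x \<le> norm z + 1"
        using norm_triangle_ineq4[of z "z - x"] x by simp
      then have "weight k (norm x) \<le> D * weight k (norm z)"
        using weight_mono[of "norm x" "norm z + 1" k] weight_shift[of "norm z" k] by (simp add: D_def)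
      then have "C * weight k (norm x) \<le> C * D * weight k (norm z)"
        using C(1) by (simp add: mult_left_mono mult.assoc)
      then show "norm (h x) \<le> exp (C * D * weight k (norm z))"
        using C(2)[of x] by (meson exp_le_cancel_iff order_trans)
    qed (auto intro: hol holomorphic_on_imp_continuous_on)
    then show ?thesis by simp
  qed
  then show ?thesis
    unfolding growth_def by (auto intro!: holomorphic_deriv hol)
qed

section \<open>Uniqueness of the exponents\<close>

lemma circle_mean_abs_Re_power:
  assumes "0 < r" "0 < q"
  shows "circle_mean (\<lambda>z. \<bar>Re (a * z ^ q)\<bar>) r = 2 * norm a * r ^ q / pi"
proof (cases "a = 0")
  case False
  define R where "R = norm a * r ^ q"
  have R: "0 < R" using False assms by (simp add: R_def)
  have "circle_mean (\<lambda>z. \<bar>Re (a * z ^ q)\<bar>) r = circle_mean (\<lambda>z. \<bar>Re z\<bar>) R"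
    by (rule circle_mean_comp)
      (use R assms in \<open>auto intro!: continuous_intros holomorphic_intros simp: norm_mult norm_power R_def\<close>)
  also have "\<dots> = R * circle_mean (\<lambda>z. \<bar>Re z\<bar>) 1"
    unfolding circle_mean_def using R by (simp add: abs_mult)
  finally show ?thesis by (simp add: circle_mean_abs_Re R_def)
qed (simp add: circle_mean_const)

text \<open>By Jensen's inequality a nonzero entire function of growth \<open>k < q\<close> cannot be as small as
  \<open>exp (- Re (a z\<^sup>q))\<close> on the sectors where the real part is positive.\<close>

lemma growth_exp_power_unique:
  assumes F: "growth k F" and G: "growth k G" and kq: "k < q" and a: "a \<noteq> 0"
    and eq: "\<And>z. F z * exp (a * z ^ q) = G z"
  shows "F = (\<lambda>_. 0)"
proof (rule ccontr)
  assume nz: "F \<noteq> (\<lambda>_. 0)"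
  obtain C1 where C1: "0 \<le> C1" "\<And>z. norm (F z) \<le> exp (C1 * weight k (norm z))"
    by (rule growthE[OF F]) blast
  obtain C2 where C2: "0 \<le> C2" "\<And>z. norm (G z) \<le> exp (C2 * weight k (norm z))"
    by (rule growthE[OF G]) blast
  obtain c n where J: "\<forall>\<rho> B. 0 < \<rho> \<longrightarrow> continuous_on (sphere 0 \<rho>) B \<longrightarrow>
      (\<forall>z. norm z = \<rho> \<longrightarrow> norm (F z) \<le> exp (B z)) \<longrightarrow> c + real n * ln \<rho> \<le> circle_mean B \<rho>"
    using Jensen_lower_bound[OF growth_holomorphic[OF F] nz] by blast
  define C where "C = C1 + C2"
  have bd: "c \<le> C * weight k r - norm a / pi * r ^ q" if r: "1 \<le> r" for r
  proof -
    \<comment> \<open>The subtracted term is the positive part of \<open>Re (a * z ^ q)\<close>,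
      written with an absolute value whose mean is known. Where the real part is nonnegative, the
      bound for \<open>G\<close> controls \<open>F\<close> with the gain
      \<open>exp (- Re (a * z ^ q))\<close>; elsewhere the bound for \<open>F\<close> itself
      suffices.\<close>
    define B where "B z = C * weight k r - 1 / 2 * (Re (a * z ^ q) + \<bar>Re (a * z ^ q)\<bar>)" for z
    have "c + real n * ln r \<le> circle_mean B r"
    proof (rule J[rule_format])
      fix z :: complex assume z: "norm z = r"
      have w: "0 \<le> weight k r" using r by (intro weight_nonneg) auto
      show "norm (F z) \<le> exp (B z)"
      proof (cases "0 \<le> Re (a * z ^ q)")
        case True
        have "norm (F z) * exp (Re (a * z ^ q)) = norm (G z)"
          using arg_cong[OF eq[of z], of norm] by (simp only: norm_mult norm_exp_eq_Re)
        also have "\<dots> \<le> exp (C * weight k r)"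
          by (rule order_trans[OF C2(2)]) (use z w C1 in \<open>auto simp: C_def intro!: mult_right_mono\<close>)
        finally have "norm (F z) \<le> exp (C * weight k r) / exp (Re (a * z ^ q))"
          by (simp only: pos_le_divide_eq exp_gt_zero)
        moreover have "B z = C * weight k r - Re (a * z ^ q)"
          using True unfolding B_def by (simp del: times_complex.sel)
        ultimately show ?thesis by (simp only: exp_diff)
      next
        case False
        have "norm (F z) \<le> exp (C * weight k r)"
          by (rule order_trans[OF C1(2)]) (use z w C2 in \<open>auto simp: C_def intro!: mult_right_mono\<close>)
        then show ?thesis using False by (simp add: B_def)
      qed
    qed (use r in \<open>auto simp: B_def intro!: continuous_intros\<close>)
    also have "circle_mean B r = circle_mean (\<lambda>z. C * weight k r) r
        - circle_mean (\<lambda>z. 1 / 2 * (Re (a * z ^ q) + \<bar>Re (a * z ^ q)\<bar>)) r"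
      unfolding B_def using r by (intro circle_mean_diff continuous_intros) auto
    also have "\<dots> = C * weight k r - 1 / 2 * circle_mean (\<lambda>z. Re (a * z ^ q) + \<bar>Re (a * z ^ q)\<bar>) r"
      by (simp only: circle_mean_const circle_mean_cmult)
    also have "circle_mean (\<lambda>z. Re (a * z ^ q) + \<bar>Re (a * z ^ q)\<bar>) r
        = circle_mean (\<lambda>z. Re (a * z ^ q)) r + circle_mean (\<lambda>z. \<bar>Re (a * z ^ q)\<bar>) r"
      using r by (intro circle_mean_add continuous_intros) auto
    also have "circle_mean (\<lambda>z. Re (a * z ^ q)) r = 0"
      using r kq by (subst circle_mean_Re_holomorphic) (auto intro!: holomorphic_intros)
    also have "circle_mean (\<lambda>z. \<bar>Re (a * z ^ q)\<bar>) r = 2 * norm a * r ^ q / pi"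
      using r kq by (intro circle_mean_abs_Re_power) auto
    also have "1 / 2 * (0 + 2 * norm a * r ^ q / pi) = norm a / pi * r ^ q" by simp
    finally have "c + real n * ln r \<le> C * weight k r - norm a / pi * r ^ q" .
    moreover have "0 \<le> real n * ln r" using r by simp
    ultimately show ?thesis by linarith
  qed
  define \<kappa> where "\<kappa> = norm a / pi"
  have \<kappa>: "0 < \<kappa>" using a by (simp add: \<kappa>_def)
  have C: "0 \<le> C" using C1 C2 by (simp add: C_def)
  \<comment> \<open>After division by \<open>r ^ k\<close> a linear function of \<open>r\<close> is
    bounded by a logarithmic one, which fails for large \<open>r\<close>.\<close>
  have "\<kappa> * r \<le> C + C * ln (2 + r) + \<bar>c\<bar>" if r: "1 \<le> r" for r
  proof -
    have rk: "1 \<le> r ^ k" using r by simp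
    have "r * r ^ k \<le> r ^ q" using power_increasing[of "Suc k" q r] kq r by simp
    then have "\<kappa> * r * r ^ k \<le> \<kappa> * r ^ q" using \<kappa> by simp
    also have "\<dots> \<le> C * weight k r - c" using bd[OF r] by (simp add: \<kappa>_def)
    also have "\<dots> \<le> C * r ^ k + C * ln (2 + r) * 1 + \<bar>c\<bar> * 1" by (simp add: weight_def algebra_simps)
    also have "\<dots> \<le> C * r ^ k + C * ln (2 + r) * r ^ k + \<bar>c\<bar> * r ^ k"
      using rk C r by (intro add_mono mult_left_mono) auto
    finally have "\<kappa> * r * r ^ k \<le> (C + C * ln (2 + r) + \<bar>c\<bar>) * r ^ k" by (simp add: algebra_simps)
    then show ?thesis using rk by (simp add: mult_le_cancel_right)
  qed
  moreover have "eventually (\<lambda>r. \<kappa> * r > C + C * ln (2 + r) + \<bar>c\<bar>) at_top"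
    using \<kappa> by real_asymp
  ultimately show False
    using eventually_happens[OF eventually_conj[OF _ eventually_ge_at_top[of "1::real"]]]
    by (metis (mono_tags, lifting) eventually_at_top_linorder linorder_not_le max.cobounded1 max.cobounded2)
qed

section \<open>Elimination by linear differential operators\<close>

lemma proportional_if_wronskian_zero:
  assumes x: "x holomorphic_on UNIV" and y: "y holomorphic_on UNIV" and nz: "y \<noteq> (\<lambda>_. 0)"
    and W: "\<And>z. y z * deriv x z = deriv y z * x z"
  shows "\<exists>c. \<forall>z. x z = c * y z"
proof -
  obtain z0 where z0: "y z0 \<noteq> 0" using nz by auto
  have "continuous (at z0) y"
    using y holomorphic_on_imp_continuous_on continuous_on_eq_continuous_at by blast
  then obtain e where e: "0 < e" "\<And>z. dist z0 z < e \<Longrightarrow> y z \<noteq> 0"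
    using continuous_at_avoid[of z0 y 0] z0 by blast
  have dx: "(x has_field_derivative deriv x z) (at z)" and dy: "(y has_field_derivative deriv y z) (at z)" for z
    using x y by (auto intro!: holomorphic_derivI)
  \<comment> \<open>Near a point where \<open>y\<close> does not vanish the quotient has derivative
    0. The identity theorem then extends the proportionality to the plane.\<close>
  have "\<exists>c. \<forall>z\<in>ball z0 e. x z / y z = c"
  proof (rule has_field_derivative_zero_constant)
    fix z assume "z \<in> ball z0 e"
    then have yz: "y z \<noteq> 0" using e by auto
    have "((\<lambda>z. x z / y z) has_field_derivative (deriv x z * y z - x z * deriv y z) / (y z * y z)) (at z)"
      by (rule DERIV_divide[OF dx dy yz])
    moreover have "deriv x z * y z - x z * deriv y z = 0" using W[of z] by (simp add: mult.commute)
    ultimately show "((\<lambda>z. x z / y z) has_field_derivative 0) (at z within ball z0 e)"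
      by (simp add: has_field_derivative_at_within)
  qed auto
  then obtain c where c: "\<And>z. z \<in> ball z0 e \<Longrightarrow> x z = c * y z"
    using e(2) by (metis mem_ball nonzero_divide_eq_eq)
  have "x z - c * y z = 0" for z
  proof (rule analytic_continuation_open[of "ball z0 e" UNIV "\<lambda>z. x z - c * y z" "\<lambda>_. 0"])
    show "(\<lambda>z. x z - c * y z) holomorphic_on UNIV" by (intro holomorphic_intros x y)
  qed (use e c in auto)
  then show ?thesis by (intro exI[of _ c]) simp
qed

text \<open>Images of \<open>f\<close> under linear differential operators whose coefficients have growth \<open>k\<close>.\<close>

inductive diff_op :: "nat \<Rightarrow> (complex \<Rightarrow> complex) \<Rightarrow> (complex \<Rightarrow> complex) \<Rightarrow> bool" for k f where
  ident: "diff_op k f f"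
| mult: "growth k a \<Longrightarrow> diff_op k f g \<Longrightarrow> diff_op k f (\<lambda>z. a z * g z)"
| add: "diff_op k f g \<Longrightarrow> diff_op k f h \<Longrightarrow> diff_op k f (\<lambda>z. g z + h z)"
| deriv: "diff_op k f g \<Longrightarrow> diff_op k f (deriv g)"

lemma diff_op_trans:
  assumes "diff_op k g h" "diff_op k f g"
  shows "diff_op k f h"
  using assms by induction (auto intro: diff_op.intros)

text \<open>Induction on the operator. Multiplication costs the growth of the coefficient; a
  derivative is a Cauchy estimate on a smaller disc and costs a factor of order
  \<open>1 / s\<close>. \<open>C\<close> and \<open>N\<close> are uniform in the disc and in
  \<open>M\<close>.\<close>

lemma diff_op_bound:
  assumes "diff_op k f g" and f: "f holomorphic_on UNIV"
  shows "g holomorphic_on UNIV \<and> (\<exists>C N. 0 \<le> C \<and> (\<forall>z s M. 0 < s \<longrightarrow> s \<le> 1 \<longrightarrow>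
    (\<forall>\<zeta>\<in>cball z s. norm (f \<zeta>) \<le> M) \<longrightarrow> norm (g z) \<le> exp (C * weight k (norm z)) * (1 / s) ^ N * M))"
  using assms(1)
proof induction
  case ident
  show ?case using f by (intro conjI exI[of _ 0]) auto
next
  case (mult a g)
  obtain C N where C: "0 \<le> C" and g: "g holomorphic_on UNIV"
    "\<And>z s M. \<lbrakk>0 < s; s \<le> 1; \<forall>\<zeta>\<in>cball z s. norm (f \<zeta>) \<le> M\<rbrakk> \<Longrightarrow>
      norm (g z) \<le> exp (C * weight k (norm z)) * (1 / s) ^ N * M"
    using mult.IH by blast
  obtain D where D: "0 \<le> D" "\<And>z. norm (a z) \<le> exp (D * weight k (norm z))"
    by (rule growthE[OF mult.hyps(1)]) blast
  have "norm (a z * g z) \<le> exp ((D + C) * weight k (norm z)) * (1 / s) ^ N * M"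
    if "0 < s" "s \<le> 1" "\<forall>\<zeta>\<in>cball z s. norm (f \<zeta>) \<le> M" for z s M
    using mult_mono[OF D(2)[of z] g(2)[OF that]] by (simp add: norm_mult distrib_right exp_add mult.assoc)
  then show ?case
    using C D g growth_holomorphic[OF mult.hyps(1)]
    by (intro conjI exI[of _ "D + C"] exI[of _ N]) (auto intro!: holomorphic_intros)
next
  case (add g h)
  obtain C N where C: "0 \<le> C" and g: "g holomorphic_on UNIV"
    "\<And>z s M. \<lbrakk>0 < s; s \<le> 1; \<forall>\<zeta>\<in>cball z s. norm (f \<zeta>) \<le> M\<rbrakk> \<Longrightarrow>
      norm (g z) \<le> exp (C * weight k (norm z)) * (1 / s) ^ N * M"
    using add.IH(1) by blast
  obtain D N' where D: "0 \<le> D" and h: "h holomorphic_on UNIV"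
    "\<And>z s M. \<lbrakk>0 < s; s \<le> 1; \<forall>\<zeta>\<in>cball z s. norm (f \<zeta>) \<le> M\<rbrakk> \<Longrightarrow>
      norm (h z) \<le> exp (D * weight k (norm z)) * (1 / s) ^ N' * M"
    using add.IH(2) by blast
  have "norm (g z + h z) \<le> exp ((C + D + 2) * weight k (norm z)) * (1 / s) ^ (N + N') * M"
    if s: "0 < s" "s \<le> 1" and M: "\<forall>\<zeta>\<in>cball z s. norm (f \<zeta>) \<le> M" for z s M
  proof -
    let ?w = "weight k (norm z)"
    have w: "1 / 2 \<le> ?w" by (rule weight_ge) auto
    have M0: "0 \<le> M" using M s by (metis centre_in_cball less_imp_le norm_ge_zero order_trans)
    have s1: "1 \<le> 1 / s" using s by simp
    have "norm (g z) \<le> exp (C * ?w) * (1 / s) ^ N * M" by (rule g(2)[OF s M])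
    also have "\<dots> \<le> exp ((C + D) * ?w) * (1 / s) ^ (N + N') * M"
      using C D w s s1 M0 by (intro mult_mono power_increasing) (auto simp: distrib_right)
    finally have 1: "norm (g z) \<le> exp ((C + D) * ?w) * (1 / s) ^ (N + N') * M" .
    have "norm (h z) \<le> exp (D * ?w) * (1 / s) ^ N' * M" by (rule h(2)[OF s M])
    also have "\<dots> \<le> exp ((C + D) * ?w) * (1 / s) ^ (N + N') * M"
      using C D w s s1 M0 by (intro mult_mono power_increasing) (auto simp: distrib_right)
    finally have 2: "norm (h z) \<le> exp ((C + D) * ?w) * (1 / s) ^ (N + N') * M" .
    have "norm (g z + h z) \<le> 2 * (exp ((C + D) * ?w) * (1 / s) ^ (N + N') * M)"
      using norm_triangle_ineq[of "g z" "h z"] 1 2 by linarith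
    also have "\<dots> \<le> exp (2 * ?w) * (exp ((C + D) * ?w) * (1 / s) ^ (N + N') * M)"
      using w exp_ge_add_one_self[of "2 * ?w"] s M0 by (intro mult_right_mono) (linarith, simp)
    also have "\<dots> = exp ((C + D + 2) * ?w) * (1 / s) ^ (N + N') * M"
      by (simp add: distrib_right exp_add)
    finally show ?thesis .
  qed
  then show ?case
    using C D g h by (intro conjI exI[of _ "C + D + 2"] exI[of _ "N + N'"]) (auto intro!: holomorphic_intros)
next
  case (deriv g)
  obtain C N where C: "0 \<le> C" and g: "g holomorphic_on UNIV"
    "\<And>z s M. \<lbrakk>0 < s; s \<le> 1; \<forall>\<zeta>\<in>cball z s. norm (f \<zeta>) \<le> M\<rbrakk> \<Longrightarrow>
      norm (g z) \<le> exp (C * weight k (norm z)) * (1 / s) ^ N * M"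
    using deriv.IH by blast
  define D where "D = (2 ^ (k + 1) + 2 ^ k + 2 :: real)"
  \<comment> \<open>Absorbs the factor \<open>2 ^ (N + 1)\<close> caused by halving the radius. The
    logarithm is doubled because the weight is only bounded below by 1/2.\<close>
  define L where "L = 2 * ln (2 ^ (N + 1) :: real)"
  have L: "0 \<le> L" unfolding L_def by (intro mult_nonneg_nonneg ln_ge_zero one_le_power) auto
  have "norm (deriv g z) \<le> exp ((C * D + L) * weight k (norm z)) * (1 / s) ^ (N + 1) * M"
    if s: "0 < s" "s \<le> 1" and M: "\<forall>\<zeta>\<in>cball z s. norm (f \<zeta>) \<le> M" for z s M
  proof -
    let ?w = "weight k (norm z)"
    have w: "1 / 2 \<le> ?w" by (rule weight_ge) auto
    have M0: "0 \<le> M" using M s by (metis centre_in_cball less_imp_le norm_ge_zero order_trans)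
    \<comment> \<open>Discs of radius \<open>s / 2\<close> about points of the circle of radius
      \<open>s / 2\<close> stay in the given disc, so the induction hypothesis applies on that
      circle with the same \<open>M\<close>.\<close>
    have "norm ((deriv ^^ 1) g z) \<le> fact 1 * (exp (C * D * ?w) * (1 / (s / 2)) ^ N * M) / (s / 2) ^ 1"
    proof (rule Cauchy_inequality)
      fix x assume x: "norm (z - x) = s / 2"
      have "norm x \<le> norm z + 1"
        using norm_triangle_ineq4[of z "z - x"] x s by simp
      then have "weight k (norm x) \<le> D * ?w"
        using weight_mono[of "norm x" "norm z + 1" k] weight_shift[of "norm z" k] by (simp add: D_def)
      then have Cw: "C * weight k (norm x) \<le> C * D * ?w"
        using C by (simp add: mult_left_mono mult.assoc)
      have "\<forall>\<zeta>\<in>cball x (s / 2). norm (f \<zeta>) \<le> M"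
      proof
        fix \<zeta> assume "\<zeta> \<in> cball x (s / 2)"
        then have "dist z \<zeta> \<le> s" using x dist_triangle[of z \<zeta> x] by (simp add: dist_norm)
        then show "norm (f \<zeta>) \<le> M" using M by simp
      qed
      then have "norm (g x) \<le> exp (C * weight k (norm x)) * (1 / (s / 2)) ^ N * M"
        using s by (intro g(2)) auto
      also have "\<dots> \<le> exp (C * D * ?w) * (1 / (s / 2)) ^ N * M"
        using Cw s M0 by (intro mult_right_mono) auto
      finally show "norm (g x) \<le> exp (C * D * ?w) * (1 / (s / 2)) ^ N * M" .
    qed (use s g(1) in \<open>auto intro: holomorphic_on_subset holomorphic_on_imp_continuous_on\<close>)
    also have "\<dots> = 2 ^ (N + 1) * (exp (C * D * ?w) * (1 / s) ^ (N + 1) * M)"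
      using s by (simp add: field_simps)
    also have "\<dots> \<le> exp (L * ?w) * (exp (C * D * ?w) * (1 / s) ^ (N + 1) * M)"
    proof (intro mult_right_mono)
      have "(2::real) ^ (N + 1) = exp (L * (1 / 2))" by (simp add: L_def exp_add ln_realpow exp_of_nat_mult)
      also have "\<dots> \<le> exp (L * ?w)" unfolding exp_le_cancel_iff using w L by (intro mult_left_mono)
      finally show "(2::real) ^ (N + 1) \<le> exp (L * ?w)" .
    qed (use s M0 in auto)
    also have "\<dots> = exp ((C * D + L) * ?w) * (1 / s) ^ (N + 1) * M"
      by (simp add: distrib_right exp_add)
    finally show ?thesis by simp
  qed
  moreover have "0 \<le> C * D + L" using C L by (simp add: D_def)
  ultimately show ?case
    using g by (intro conjI exI[of _ "C * D + L"] exI[of _ "N + 1"]) (auto intro!: holomorphic_deriv)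
qed

text \<open>Induction on the terms to be removed. The combination
  \<open>H i * deriv f - E i * f\<close> has no term of index \<open>i\<close>, and the other terms
  keep their exponentials, with new coefficients that are again nonzero and of growth
  \<open>k\<close>.\<close>

lemma exp_sum_elimination:
  assumes "finite I" "j \<notin> I" "k < q" "inj_on w (insert j I)"
    and "\<And>i. i \<in> insert j I \<Longrightarrow> growth k (H i) \<and> H i \<noteq> (\<lambda>_. 0)"
  shows "\<exists>A. growth k A \<and> A \<noteq> (\<lambda>_. 0) \<and>
    diff_op k (\<lambda>z. \<Sum>i\<in>insert j I. H i z * exp (w i * z ^ q)) (\<lambda>z. A z * exp (w j * z ^ q))"
  using assms
proof (induction I arbitrary: H rule: finite_induct)
  case empty
  have "diff_op k (\<lambda>z. H j z * exp (w j * z ^ q)) (\<lambda>z. H j z * exp (w j * z ^ q))"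
    by (rule diff_op.ident)
  then show ?case using empty by auto
next
  case (insert i I)
  define f where "f z = (\<Sum>l\<in>insert j (insert i I). H l z * exp (w l * z ^ q))" for z
  \<comment> \<open>\<open>E l\<close> is the coefficient of the exponential in the derivative of
    term \<open>l\<close>. \<open>G l\<close> is then the Wronskian of terms \<open>i\<close> and
    \<open>l\<close> without the exponentials.\<close>
  define E where "E l z = deriv (H l) z + w l * of_nat q * z ^ (q - 1) * H l z" for l z
  define G where "G l z = H i z * E l z - E i z * H l z" for l z
  have gH: "growth k (H l)" if "l \<in> insert j (insert i I)" for l using insert.prems that by blast
  have gE: "growth k (E l)" if "l \<in> insert j (insert i I)" for l
    unfolding E_def using that by (intro growth_add growth_mult growth_deriv growth_const growth_power gH)
  have gG: "growth k (G l)" if "l \<in> insert j (insert i I)" for l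
    unfolding G_def using that by (intro growth_diff growth_mult gE gH) auto
  have dH: "((\<lambda>z. H l z * exp (w l * z ^ q)) has_field_derivative E l z * exp (w l * z ^ q)) (at z)"
    if "l \<in> insert j (insert i I)" for l z
  proof -
    have "(H l has_field_derivative deriv (H l) z) (at z)"
      using growth_holomorphic[OF gH[OF that]] by (auto intro!: holomorphic_derivI)
    then show ?thesis
      by (auto intro!: derivative_eq_intros simp: E_def algebra_simps)
  qed
  \<comment> \<open>If \<open>G l\<close> vanished, terms \<open>l\<close> and \<open>i\<close>
    would be proportional. Then \<open>H l\<close> times \<open>exp ((w l - w i) * z ^ q)\<close>
    would again have growth \<open>k < q\<close>, which forces \<open>H l\<close> to vanish.\<close>
  have nzG: "G l \<noteq> (\<lambda>_. 0)" if l: "l \<in> insert j I" for l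
  proof
    assume G0: "G l = (\<lambda>_. 0)"
    have li: "l \<in> insert j (insert i I)" "l \<noteq> i" using l insert by auto
    let ?x = "\<lambda>z. H l z * exp (w l * z ^ q)" and ?y = "\<lambda>z. H i z * exp (w i * z ^ q)"
    have "\<exists>c. \<forall>z. ?x z = c * ?y z"
    proof (rule proportional_if_wronskian_zero)
      show "?x holomorphic_on UNIV" "?y holomorphic_on UNIV"
        using gH growth_holomorphic li by (auto intro!: holomorphic_intros)
      obtain z where "H i z \<noteq> 0" using insert.prems by blast
      then have "?y z \<noteq> 0" by simp
      then show "?y \<noteq> (\<lambda>_. 0)" by metis
      fix z
      have d: "deriv ?x z = E l z * exp (w l * z ^ q)" "deriv ?y z = E i z * exp (w i * z ^ q)"
        using dH li by (auto intro!: DERIV_imp_deriv)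
      have "H i z * E l z = E i z * H l z" using fun_cong[OF G0, of z] by (simp add: G_def)
      then show "?y z * deriv ?x z = deriv ?y z * ?x z" unfolding d by algebra
    qed
    then obtain c where c: "\<And>z. ?x z = c * ?y z" by blast
    have "H l = (\<lambda>_. 0)"
    proof (rule growth_exp_power_unique)
      show "growth k (H l)" "growth k (\<lambda>z. c * H i z)" using gH li by (auto intro: growth_mult growth_const)
      have "w l \<noteq> w i" using li insert.prems(3) inj_onD[of w "insert j (insert i I)" l i] by blast
      then show "w l - w i \<noteq> 0" by simp
      show "H l z * exp ((w l - w i) * z ^ q) = c * H i z" for z
        using c[of z] by (simp add: left_diff_distrib exp_diff field_simps)
    qed fact
    then show False using insert.prems(4) li by blast
  qed
  have deriv_f: "deriv f z = (\<Sum>l\<in>insert j (insert i I). E l z * exp (w l * z ^ q))" for z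
    unfolding f_def by (intro DERIV_imp_deriv DERIV_sum dH)
  have "H i z * deriv f z + (- 1 * E i z) * f z = (\<Sum>l\<in>insert j I. G l z * exp (w l * z ^ q))" for z
  proof -
    have "H i z * deriv f z + (- 1 * E i z) * f z = (\<Sum>l\<in>insert i (insert j I). G l z * exp (w l * z ^ q))"
      unfolding deriv_f f_def
      by (simp add: sum_distrib_left sum.distrib[symmetric] G_def left_diff_distrib mult.assoc insert_commute
          del: sum.insert)
    also have "\<dots> = (\<Sum>l\<in>insert j I. G l z * exp (w l * z ^ q))"
      using insert by (subst sum.insert) (auto simp: G_def)
    finally show ?thesis .
  qed
  moreover have "diff_op k f (\<lambda>z. H i z * deriv f z + (- 1 * E i z) * f z)"
    by (intro diff_op.intros growth_mult growth_const gH gE) auto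
  ultimately have 1: "diff_op k f (\<lambda>z. \<Sum>l\<in>insert j I. G l z * exp (w l * z ^ q))" by simp
  have "\<exists>A. growth k A \<and> A \<noteq> (\<lambda>_. 0) \<and>
    diff_op k (\<lambda>z. \<Sum>l\<in>insert j I. G l z * exp (w l * z ^ q)) (\<lambda>z. A z * exp (w j * z ^ q))"
    using insert.prems gG nzG by (intro insert.IH) (auto intro: inj_on_subset)
  then show ?case using diff_op_trans[OF _ 1] unfolding f_def by blast
qed

subsection \<open>The two bounds for the circle mean\<close>

lemma norm_power_diff_le:
  fixes a b :: "'a::real_normed_field"
  assumes "norm a \<le> r" "norm b \<le> r"
  shows "norm (a ^ n - b ^ n) \<le> real n * r ^ (n - 1) * norm (a - b)"
proof (induction n)
  case (Suc n)
  have r: "0 \<le> r" using assms(1) norm_ge_zero order_trans by blast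
  have "a ^ Suc n - b ^ Suc n = a * (a ^ n - b ^ n) + (a - b) * b ^ n" by (simp add: algebra_simps)
  then have "norm (a ^ Suc n - b ^ Suc n) \<le> norm a * norm (a ^ n - b ^ n) + norm (a - b) * norm b ^ n"
    by (metis norm_triangle_ineq norm_mult norm_power)
  also have "\<dots> \<le> r * (real n * r ^ (n - 1) * norm (a - b)) + norm (a - b) * r ^ n"
    using assms Suc r by (intro add_mono mult_mono power_mono) auto
  also have "\<dots> = real (Suc n) * r ^ (Suc n - 1) * norm (a - b)"
    by (cases n) (simp_all add: algebra_simps)
  finally show ?case .
qed simp

text \<open>The power map carries the mean to the circle of radius \<open>r ^ q\<close>, and
  homogeneity of the support function brings it back to the unit circle.\<close>

lemma circle_mean_support_power:
  fixes X :: "complex set"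
  assumes X: "finite X" "X \<noteq> {}" and "0 < r" "0 < q"
  shows "circle_mean (\<lambda>z. support X (z ^ q)) r = r ^ q * circle_mean (support X) 1"
proof -
  have "circle_mean (\<lambda>z. support X (z ^ q)) r = circle_mean (support X) (r ^ q)"
    using assms by (intro circle_mean_comp continuous_on_support) (auto intro!: holomorphic_intros simp: norm_power)
  also have "\<dots> = circle_mean (\<lambda>u. r ^ q * support X u) 1"
    unfolding circle_mean_def
    using support_scale[OF X, of "r ^ q"] assms(3) by (simp add: scaleR_conv_of_real)
  finally show ?thesis by (simp only: circle_mean_cmult)
qed

lemma holomorphic_mult_nonzero:
  assumes "F holomorphic_on UNIV" "G holomorphic_on UNIV" "F \<noteq> (\<lambda>_. 0)" "G \<noteq> (\<lambda>_. 0)"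
  shows "(\<lambda>z. F z * G z) \<noteq> (\<lambda>_. 0)"
proof
  assume 0: "(\<lambda>z. F z * G z) = (\<lambda>_. 0)"
  obtain z0 where z0: "F z0 \<noteq> 0" using assms(3) by auto
  have "continuous (at z0) F"
    using assms(1) holomorphic_on_imp_continuous_on continuous_on_eq_continuous_at by blast
  then obtain e where e: "0 < e" "\<And>z. dist z0 z < e \<Longrightarrow> F z \<noteq> 0"
    using continuous_at_avoid[of z0 F 0] z0 by blast
  have "G z = 0" for z
  proof (rule analytic_continuation_open[of "ball z0 e" UNIV G "\<lambda>_. 0"])
    fix z assume "z \<in> ball z0 e"
    then show "G z = 0" using e(2)[of z] fun_cong[OF 0, of z] by auto
  qed (use e assms in auto)
  then show False using assms(4) by blast
qed

lemma holomorphic_prod_nonzero: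
  assumes "finite I" "\<And>i. i \<in> I \<Longrightarrow> F i holomorphic_on UNIV" "\<And>i. i \<in> I \<Longrightarrow> F i \<noteq> (\<lambda>_. 0)"
  shows "(\<lambda>z. \<Prod>i\<in>I. F i z) \<noteq> (\<lambda>_. 0)"
  using assms
proof (induction I)
  case empty
  then show ?case by (auto dest: fun_cong)
next
  case (insert i I)
  have "(\<lambda>z. F i z * (\<Prod>i\<in>I. F i z)) \<noteq> (\<lambda>_. 0)"
    by (rule holomorphic_mult_nonzero) (use insert in \<open>auto intro!: holomorphic_intros\<close>)
  then show ?case using insert by simp
qed

section \<open>Pointwise bounds for the exponential sum\<close>

lemma exp_sum_upper:
  fixes w :: "nat \<Rightarrow> complex"
  assumes "\<And>j. j \<le> m \<Longrightarrow> growth k (H j)" and U: "\<And>j z. j \<le> m \<Longrightarrow> Re (w j * z ^ q) \<le> U z"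
  shows "\<exists>C\<ge>0. \<forall>z. norm (\<Sum>j\<le>m. H j z * exp (w j * z ^ q)) \<le> exp (U z + C * weight k (norm z))"
proof -
  have "\<forall>j\<in>{..m}. \<exists>C\<ge>0. \<forall>z. norm (H j z) \<le> exp (C * weight k (norm z))"
    using assms(1) growthE by (metis atMost_iff)
  then obtain C where C: "\<And>j. j \<le> m \<Longrightarrow> 0 \<le> C j"
    "\<And>j z. j \<le> m \<Longrightarrow> norm (H j z) \<le> exp (C j * weight k (norm z))"
    by (metis atMost_iff)
  define D where "D = sum C {..m}"
  define E where "E = 2 * ln (real (Suc m))"
  have E: "0 \<le> E" unfolding E_def by simp
  have D: "0 \<le> D" unfolding D_def using C by (intro sum_nonneg) auto
  have "norm (\<Sum>j\<le>m. H j z * exp (w j * z ^ q)) \<le> exp (U z + (E + D) * weight k (norm z))" for z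
  proof -
    let ?w = "weight k (norm z)"
    have w: "1 / 2 \<le> ?w" by (rule weight_ge) auto
    have "norm (\<Sum>j\<le>m. H j z * exp (w j * z ^ q)) \<le> (\<Sum>j\<le>m. exp (D * ?w) * exp (U z))"
    proof (intro sum_norm_le)
      fix j assume j: "j \<in> {..m}"
      have "C j \<le> D" unfolding D_def using j C by (intro member_le_sum) auto
      then have "norm (H j z) \<le> exp (D * ?w)"
        using C(2)[of j z] j w by (meson atMost_iff exp_le_cancel_iff mult_right_mono order_trans weight_nonneg norm_ge_zero)
      moreover have "norm (exp (w j * z ^ q)) \<le> exp (U z)"
        using U[of j z] j by (simp only: norm_exp_eq_Re exp_le_cancel_iff atMost_iff)
      ultimately show "norm (H j z * exp (w j * z ^ q)) \<le> exp (D * ?w) * exp (U z)"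
        unfolding norm_mult by (intro mult_mono) auto
    qed
    also have "\<dots> = exp (E * (1 / 2)) * (exp (D * ?w) * exp (U z))"
      by (simp add: E_def exp_ln)
    also have "\<dots> \<le> exp (E * ?w) * (exp (D * ?w) * exp (U z))"
    proof (rule mult_right_mono)
      show "exp (E * (1 / 2)) \<le> exp (E * ?w)"
        unfolding exp_le_cancel_iff using w E by (intro mult_left_mono)
    qed simp
    also have "\<dots> = exp (U z + (E + D) * ?w)" by (simp add: distrib_right exp_add mult_ac)
    finally show ?thesis .
  qed
  then show ?thesis using D E by (intro exI[of _ "E + D"]) auto
qed

text \<open>Which exponential dominates depends on the point. A single \<open>A\<close> for all
  points is the product of the functions obtained by eliminating down to each
  \<open>j \<ge> 1\<close>: where term \<open>j\<close> dominates, its own factor is paired with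
  \<open>exp (U z)\<close>, and the others are bounded by their growth.\<close>

lemma exp_sum_lower:
  fixes w :: "nat \<Rightarrow> complex"
  assumes gH: "\<And>j. j \<le> m \<Longrightarrow> growth k (H j)" and kq: "k < q" and w0: "w 0 = 0" and inj: "inj_on w {..m}"
    and nz: "\<And>j. 1 \<le> j \<Longrightarrow> j \<le> m \<Longrightarrow> H j \<noteq> (\<lambda>_. 0)"
    and f: "\<And>z. f z = (\<Sum>j\<le>m. H j z * exp (w j * z ^ q))"
    and U: "\<And>z. \<exists>j\<le>m. U z = Re (w j * z ^ q)"
  shows "\<exists>A C N. A holomorphic_on UNIV \<and> A \<noteq> (\<lambda>_. 0) \<and> 0 \<le> C \<and>
    (\<forall>z s M. 0 < s \<longrightarrow> s \<le> 1 \<longrightarrow> 1 \<le> M \<longrightarrow> (\<forall>\<zeta>\<in>cball z s. norm (f \<zeta>) \<le> M) \<longrightarrow>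
      norm (A z) * exp (U z) \<le> exp (C * weight k (norm z)) * (1 / s) ^ N * M)"
proof -
  have f_eq: "f = (\<lambda>z. \<Sum>j\<le>m. H j z * exp (w j * z ^ q))" using f by blast
  have hf: "f holomorphic_on UNIV"
    unfolding f_eq using gH growth_holomorphic by (auto intro!: holomorphic_intros)
  have "\<forall>j\<in>{1..m}. \<exists>A C N. growth k A \<and> A \<noteq> (\<lambda>_. 0) \<and> 0 \<le> C \<and>
    (\<forall>z s M. 0 < s \<longrightarrow> s \<le> 1 \<longrightarrow> (\<forall>\<zeta>\<in>cball z s. norm (f \<zeta>) \<le> M) \<longrightarrow>
      norm (A z * exp (w j * z ^ q)) \<le> exp (C * weight k (norm z)) * (1 / s) ^ N * M)"
  proof
    fix j assume j: "j \<in> {1..m}"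
    \<comment> \<open>Elimination needs nonzero coefficients, so a term that vanishes identically,
      possibly that of index 0, is left out.\<close>
    define I where "I = {i\<in>{..m}. i \<noteq> j \<and> H i \<noteq> (\<lambda>_. 0)}"
    have "f z = (\<Sum>i\<in>insert j I. H i z * exp (w i * z ^ q))" for z
      unfolding f using j by (intro sum.mono_neutral_right) (auto simp: I_def)
    then have fI: "f = (\<lambda>z. \<Sum>i\<in>insert j I. H i z * exp (w i * z ^ q))" by blast
    have "\<exists>A. growth k A \<and> A \<noteq> (\<lambda>_. 0) \<and>
      diff_op k (\<lambda>z. \<Sum>i\<in>insert j I. H i z * exp (w i * z ^ q)) (\<lambda>z. A z * exp (w j * z ^ q))"
    proof (rule exp_sum_elimination)
      show "inj_on w (insert j I)" by (rule inj_on_subset[OF inj]) (use j in \<open>auto simp: I_def\<close>)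
    qed (use j gH nz kq in \<open>auto simp: I_def\<close>)
    then obtain A where A: "growth k A" "A \<noteq> (\<lambda>_. 0)" "diff_op k f (\<lambda>z. A z * exp (w j * z ^ q))"
      using fI by metis
    then show "\<exists>A C N. growth k A \<and> A \<noteq> (\<lambda>_. 0) \<and> 0 \<le> C \<and>
      (\<forall>z s M. 0 < s \<longrightarrow> s \<le> 1 \<longrightarrow> (\<forall>\<zeta>\<in>cball z s. norm (f \<zeta>) \<le> M) \<longrightarrow>
        norm (A z * exp (w j * z ^ q)) \<le> exp (C * weight k (norm z)) * (1 / s) ^ N * M)"
      using diff_op_bound[OF A(3) hf] by blast
  qed
  then obtain A C N where "\<forall>j\<in>{1..m}. growth k (A j) \<and> A j \<noteq> (\<lambda>_. 0) \<and> 0 \<le> C j \<and>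
    (\<forall>z s M. 0 < s \<longrightarrow> s \<le> 1 \<longrightarrow> (\<forall>\<zeta>\<in>cball z s. norm (f \<zeta>) \<le> M) \<longrightarrow>
      norm (A j z * exp (w j * z ^ q)) \<le> exp (C j * weight k (norm z)) * (1 / s) ^ N j * M)"
    unfolding bchoice_iff by blast
  then have gA: "\<And>j. j \<in> {1..m} \<Longrightarrow> growth k (A j)" and nzA: "\<And>j. j \<in> {1..m} \<Longrightarrow> A j \<noteq> (\<lambda>_. 0)"
    and C: "\<And>j. j \<in> {1..m} \<Longrightarrow> 0 \<le> C j"
    and bA: "\<And>j z s M. \<lbrakk>j \<in> {1..m}; 0 < s; s \<le> 1; \<forall>\<zeta>\<in>cball z s. norm (f \<zeta>) \<le> M\<rbrakk> \<Longrightarrow>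
      norm (A j z * exp (w j * z ^ q)) \<le> exp (C j * weight k (norm z)) * (1 / s) ^ N j * M"
    by blast+
  have "\<forall>j\<in>{1..m}. \<exists>D\<ge>0. \<forall>z. norm (A j z) \<le> exp (D * weight k (norm z))"
    using gA growthE by metis
  then obtain D where D: "\<And>j. j \<in> {1..m} \<Longrightarrow> 0 \<le> D j"
    "\<And>j z. j \<in> {1..m} \<Longrightarrow> norm (A j z) \<le> exp (D j * weight k (norm z))"
    by metis
  define P where "P z = (\<Prod>j\<in>{1..m}. A j z)" for z
  have prod: "norm (\<Prod>j\<in>I. A j z) \<le> exp (sum D {1..m} * weight k (norm z))" if "I \<subseteq> {1..m}" for I z
  proof -
    have w: "0 \<le> weight k (norm z)" by (rule weight_nonneg) auto
    have "norm (\<Prod>j\<in>I. A j z) \<le> (\<Prod>j\<in>I. exp (D j * weight k (norm z)))"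
      unfolding prod_norm[symmetric] using that D by (intro prod_mono) auto
    also have "\<dots> = exp (sum D I * weight k (norm z))"
      using finite_subset[OF that] by (simp add: exp_sum sum_distrib_right)
    also have "\<dots> \<le> exp (sum D {1..m} * weight k (norm z))"
      unfolding exp_le_cancel_iff using that D w by (intro mult_right_mono sum_mono2) auto
    finally show ?thesis .
  qed
  have DC: "0 \<le> sum D {1..m}" "0 \<le> sum C {1..m}" using D C by (auto intro!: sum_nonneg)
  have main: "norm (P z) * exp (U z) \<le> exp ((sum D {1..m} + sum C {1..m}) * weight k (norm z)) * (1 / s) ^ sum N {1..m} * M"
    if s: "0 < s" "s \<le> 1" and M1: "1 \<le> M" and M: "\<forall>\<zeta>\<in>cball z s. norm (f \<zeta>) \<le> M" for z s M
  proof -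
    let ?w = "weight k (norm z)"
    have w: "0 \<le> ?w" by (rule weight_nonneg) auto
    have s1: "1 \<le> 1 / s" using s by simp
    obtain j where j: "j \<le> m" "U z = Re (w j * z ^ q)" using U by blast
    have e: "norm (exp (w j * z ^ q)) = exp (U z)" using j by (simp only: norm_exp_eq_Re)
    show ?thesis
    proof (cases "j = 0")
      case True
      \<comment> \<open>Here \<open>U z = 0\<close>, so \<open>H 0\<close>, which may vanish identically, need not be eliminated for.\<close>
      have "norm (P z) * exp (U z) = norm (P z) * 1 * 1" using True j w0 by simp
      also have "\<dots> \<le> exp ((sum D {1..m} + sum C {1..m}) * ?w) * (1 / s) ^ sum N {1..m} * M"
      proof (intro mult_mono)
        have "norm (P z) \<le> exp (sum D {1..m} * ?w)" unfolding P_def by (rule prod) simp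
        also have "\<dots> \<le> exp ((sum D {1..m} + sum C {1..m}) * ?w)"
          using DC w by (simp add: mult_right_mono)
        finally show "norm (P z) \<le> exp ((sum D {1..m} + sum C {1..m}) * ?w)" .
        show "1 \<le> (1 / s) ^ sum N {1..m}" using s1 by (rule one_le_power)
      qed (use s M1 in auto)
      finally show ?thesis .
    next
      case False
      then have j1: "j \<in> {1..m}" using j by simp
      have "norm (P z) * exp (U z) = norm (A j z * exp (w j * z ^ q)) * norm (\<Prod>i\<in>{1..m} - {j}. A i z)"
      proof -
        have "P z = A j z * (\<Prod>i\<in>{1..m} - {j}. A i z)"
          unfolding P_def by (rule prod.remove) (use j1 in auto)
        then show ?thesis by (simp only: norm_mult e mult_ac)
      qed
      also have "\<dots> \<le> (exp (C j * ?w) * (1 / s) ^ N j * M) * exp (sum D {1..m} * ?w)"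
        using s M1 by (intro mult_mono bA j1 s M prod) auto
      also have "\<dots> \<le> (exp (sum C {1..m} * ?w) * (1 / s) ^ sum N {1..m} * M) * exp (sum D {1..m} * ?w)"
      proof (intro mult_right_mono mult_mono)
        have "C j \<le> sum C {1..m}" using C j1 by (intro member_le_sum) auto
        then show "exp (C j * ?w) \<le> exp (sum C {1..m} * ?w)" using w by (simp add: mult_right_mono)
        have "N j \<le> sum N {1..m}" using j1 by (intro member_le_sum) auto
        then show "(1 / s) ^ N j \<le> (1 / s) ^ sum N {1..m}" using s1 by (intro power_increasing)
      qed (use s M1 in auto)
      also have "\<dots> = exp ((sum D {1..m} + sum C {1..m}) * ?w) * (1 / s) ^ sum N {1..m} * M"
        by (simp add: distrib_right exp_add)
      finally show ?thesis .
    qed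
  qed
  have hA: "A j holomorphic_on UNIV" if "j \<in> {1..m}" for j
    using growth_holomorphic[OF gA[OF that]] .
  have "P holomorphic_on UNIV"
    unfolding P_def by (intro holomorphic_intros hA)
  moreover have "P \<noteq> (\<lambda>_. 0)"
    unfolding P_def by (intro holomorphic_prod_nonzero hA nzA) auto
  ultimately show ?thesis using main DC
    by (intro exI[of _ P] exI[of _ "sum D {1..m} + sum C {1..m}"] exI[of _ "sum N {1..m}"]) auto
qed

section \<open>The mean of the positive logarithm from below\<close>

lemma positive_log_continuous:
  assumes "continuous_on S f"
  shows "continuous_on S (\<lambda>z. max 0 (ln (norm (f z :: complex))))"
proof -
  \<comment> \<open>This form is visibly continuous also at zeros of \<open>f\<close>, where the
    convention \<open>ln 0 = 0\<close> agrees with \<open>ln 1\<close>.\<close>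
  have "max 0 (ln (norm x)) = ln (max 1 (norm x))" for x :: complex
    by (cases "norm x \<le> 1"; cases "x = 0") (auto simp: max_def)
  then show ?thesis
    using assms by (auto intro!: continuous_intros)
qed

lemma norm_le_exp_positive_log: "norm x \<le> exp (max 0 (ln (norm x)))" for x :: complex
proof (cases "x = 0")
  case False
  then have "norm x = exp (ln (norm x))" by simp
  also have "\<dots> \<le> exp (max 0 (ln (norm x)))" by simp
  finally show ?thesis .
qed simp

lemma positive_log_le:
  fixes x :: complex
  assumes "norm x \<le> exp b" "0 \<le> b"
  shows "max 0 (ln (norm x)) \<le> b"
proof (cases "x = 0")
  case False
  then have "ln (norm x) \<le> ln (exp b)" using assms by (intro ln_mono) auto
  then show ?thesis using assms by simp
qed (use assms in simp)

text \<open>Of the exponential sum only the two estimates \<open>up\<close> and \<open>lo\<close>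
  are kept; the rest is potential theory for \<open>U\<close> and \<open>f\<close>.\<close>

lemma circle_mean_lower:
  fixes X :: "complex set" and f :: "complex \<Rightarrow> complex" and p q k :: nat
  defines "U \<equiv> (\<lambda>z. support X (z ^ q))" and "L \<equiv> (\<lambda>z. max 0 (ln (norm (f z))))"
  assumes X: "finite X" "0 \<in> X" and pq: "1 \<le> p" "p \<le> q" and k: "k = q - p"
    and hf: "f holomorphic_on UNIV"
    and up: "0 \<le> C1" "\<And>z. norm (f z) \<le> exp (U z + C1 * weight k (norm z))"
    and A: "A holomorphic_on UNIV" "A \<noteq> (\<lambda>_. 0)" and C2: "0 \<le> C2"
    and lo: "\<And>z s M. \<lbrakk>0 < s; s \<le> 1; 1 \<le> M; \<forall>\<zeta>\<in>cball z s. norm (f \<zeta>) \<le> M\<rbrakk> \<Longrightarrow>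
      norm (A z) * exp (U z) \<le> exp (C2 * weight k (norm z)) * (1 / s) ^ N * M"
  shows "\<exists>C. \<forall>r\<ge>2. circle_mean U r - circle_mean L r \<le> C * weight k r"
proof -
  obtain c n where J: "\<forall>\<rho> B. 0 < \<rho> \<longrightarrow> continuous_on (sphere 0 \<rho>) B \<longrightarrow>
      (\<forall>z. norm z = \<rho> \<longrightarrow> norm (A z) \<le> exp (B z)) \<longrightarrow> c + real n * ln \<rho> \<le> circle_mean B \<rho>"
    using Jensen_lower_bound[OF A] by blast
  have X': "X \<noteq> {}" using X by auto
  define S where "S = (\<Sum>x\<in>X. norm x)"
  have S: "0 \<le> S" "\<And>x. x \<in> X \<Longrightarrow> norm x \<le> S"
    unfolding S_def using X by (auto intro: sum_nonneg member_le_sum)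
  define K where "K = circle_mean (support X) 1"
  have Upos: "0 \<le> U z" for z
    using support_mono_point[OF X(1,2), of "z ^ q"] by (simp add: U_def)
  have Uge: "x \<bullet> z ^ q \<le> U z" if "x \<in> X" for x z
    using support_mono_point[OF X(1) that] by (simp add: U_def)
  have cU: "continuous_on T U" for T
    unfolding U_def
    by (rule continuous_on_compose2[OF continuous_on_support[OF X(1) X', of UNIV]]) (auto intro!: continuous_intros)
  have cL: "continuous_on T L" for T
    unfolding L_def using hf holomorphic_on_imp_continuous_on continuous_on_subset
    by (intro positive_log_continuous) blast
  have K: "0 \<le> K"
  proof -
    have "circle_mean (\<lambda>_. 0) 1 \<le> circle_mean (support X) 1"
      using support_mono_point[OF X] X X' by (intro circle_mean_mono continuous_on_support) auto
    then show ?thesis by (simp add: circle_mean_const K_def)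
  qed
  have mU: "circle_mean U r = K * r ^ q" if "0 < r" for r
    using circle_mean_support_power[OF X(1) X' that, of q] pq by (simp add: U_def K_def)
  \<comment> \<open>\<open>C4\<close> collects the variation of the dominant term on the small disc
    and the constants built into \<open>v\<close>; \<open>C5\<close> comes from
    \<open>(1 / s) ^ N\<close>.\<close>
  define C4 where "C4 = S * real q + C1 + 2"
  define C5 where "C5 = real N * (2 * ln 4 + real p)"
  define C6 where "C6 = C2 + C5 + C4"
  define C where "C = 3 * (2 * \<bar>c\<bar> + C6 + 6 + 3 * (K * real q))"
  have "circle_mean U r - circle_mean L r \<le> C * weight k r" if r: "2 \<le> r" for r
  proof -
    define W where "W = weight k r"
    have W: "1 / 2 \<le> W" unfolding W_def using r by (intro weight_ge) auto
    have lnW: "ln r \<le> W" and rkW: "r ^ k \<le> W"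
      using r ln_mono[of r "2 + r"] unfolding W_def weight_def
      by (auto intro: add_increasing add_increasing2)
    \<comment> \<open>The radius balances two losses. On a disc of radius \<open>s\<close> the power
      \<open>z ^ q\<close> varies by O(r^(q-p)), while \<open>1 / s\<close> is at most a constant
      times a power of \<open>r\<close> and costs O(log r). The 4 gives
      \<open>s \<le> 1 / 4\<close>, hence \<open>\<rho> \<ge> 1\<close>.\<close>
    define s where "s = r / (4 * r ^ p)"
    have r1: "r \<le> r ^ p" using power_increasing[of 1 p r] pq r by simp
    have s: "0 < s" "s \<le> 1 / 4" using r r1 by (simp_all add: s_def field_simps)
    have rs: "r ^ (q - 1) * s = r ^ k / 4"
    proof -
      have "r ^ (q - 1) * r = r ^ k * r ^ p"
        using pq k by (simp flip: power_Suc2 power_add)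
      then show ?thesis using r by (simp add: s_def field_simps)
    qed
    \<comment> \<open>Discs of radius \<open>2 * s\<close> about points of modulus
      \<open>\<rho>\<close> stay in the disc of radius \<open>r\<close>, as Harnack's inequality
      requires.\<close>
    define \<rho> where "\<rho> = r - 2 * s"
    have \<rho>: "1 \<le> \<rho>" "\<rho> \<le> r" using r s by (simp_all add: \<rho>_def)
    have rq: "r ^ q - \<rho> ^ q \<le> real q * W"
    proof -
      have "norm (r ^ q - \<rho> ^ q) \<le> real q * r ^ (q - 1) * norm (r - \<rho>)"
        using \<rho> r by (intro norm_power_diff_le) auto
      also have "\<dots> = real q * (2 * (r ^ (q - 1) * s))" using s by (simp add: \<rho>_def)
      also have "\<dots> = real q * (r ^ k / 2)" unfolding rs by simp
      also have "\<dots> \<le> real q * W" using rkW r W by (intro mult_left_mono) auto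
      finally show ?thesis by simp
    qed
    have UL: "L z \<le> U z + C1 * W" if "norm z = r" for z
      unfolding L_def W_def using up Upos[of z] that r
      by (intro positive_log_le add_nonneg_nonneg mult_nonneg_nonneg weight_nonneg) auto
    obtain g where g: "g holomorphic_on UNIV" "\<And>z. norm z = r \<Longrightarrow> L z \<le> Re (g z)"
      "\<And>z. norm z = r \<Longrightarrow> Re (g z) \<le> L z + 1"
      using harmonic_majorant_on_circle[OF cL, of 1 r] by auto
    obtain G where G: "G holomorphic_on UNIV" "\<And>z. norm z = r \<Longrightarrow> U z \<le> Re (G z)"
      "\<And>z. norm z = r \<Longrightarrow> Re (G z) \<le> U z + 1"
      using harmonic_majorant_on_circle[OF cU, of 1 r] by auto
    have cRe: "continuous_on T (\<lambda>z. Re (h z))" if "h holomorphic_on UNIV" for T and h :: "complex \<Rightarrow> complex"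
      using that holomorphic_on_imp_continuous_on continuous_on_subset
      by (intro continuous_intros) blast
    \<comment> \<open>The constants make the real part nonnegative: \<open>C1 * W\<close> covers the
      excess of \<open>L\<close> over \<open>U\<close>, and 1 covers the slack in
      \<open>g\<close>.\<close>
    define v where "v z = G z + of_real (C1 * W + 1) - g z" for z
    have hv: "v holomorphic_on UNIV" unfolding v_def by (intro holomorphic_intros G g)
    have vpos: "0 \<le> Re (v z)" if "norm z \<le> r" for z
    proof (rule Re_nonneg_disc[OF hv _ that])
      fix z :: complex assume "norm z = r"
      then show "0 \<le> Re (v z)" using G(2)[of z] g(3)[of z] UL[of z] by (simp add: v_def)
    qed
    have gpos: "0 \<le> Re (g z)" if "norm z \<le> r" for z
    proof (rule Re_nonneg_disc[OF g(1) _ that])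
      fix z :: complex assume "norm z = r"
      then show "0 \<le> Re (g z)" using g(2)[of z] by (simp add: L_def)
    qed
    have Gpos: "0 \<le> Re (G z - cnj x * z ^ q)" if "norm z \<le> r" "x \<in> X" for x z
    proof (rule Re_nonneg_disc[OF _ _ that(1)])
      show "(\<lambda>z. G z - cnj x * z ^ q) holomorphic_on UNIV" by (intro holomorphic_intros G)
      fix z :: complex assume "norm z = r"
      then show "0 \<le> Re (G z - cnj x * z ^ q)"
        using G(2)[of z] Uge[OF that(2), of z] by (simp add: inner_complex_def)
    qed
    have fg: "norm (f z) \<le> exp (Re (g z))" if "norm z \<le> r" for z
    proof (rule norm_le_exp_Re_disc[OF hf g(1) _ that])
      fix z :: complex assume "norm z = r"
      then show "norm (f z) \<le> exp (Re (g z))"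
        using g(2)[of z] norm_le_exp_positive_log[of "f z"] unfolding L_def
        by (meson exp_le_cancel_iff order_trans)
    qed
    \<comment> \<open>The exponent of a bound for \<open>norm (f \<zeta>)\<close> on the small disc
      about \<open>z\<close>. The factors 3 and 1/3 come from Harnack's inequality, used from above
      for \<open>G\<close> minus the dominant term and from below for \<open>v\<close>.\<close>
    define B where "B z = U z + C4 * W + 3 * (Re (G z) - U z) - Re (v z) / 3" for z
    have AB: "norm (A z) \<le> exp (C6 * W + 3 * (Re (G z) - U z) - Re (v z) / 3)" if z: "norm z = \<rho>" for z
    proof -
      have ball: "norm \<zeta> \<le> r" if "dist z \<zeta> \<le> 2 * s" for \<zeta>
        using that z norm_triangle_ineq2[of \<zeta> z] by (simp add: \<rho>_def dist_norm norm_minus_commute)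
      have zr: "norm z \<le> r" using z \<rho> by simp
      \<comment> \<open>\<open>x\<close> attains the maximum at the centre and is kept for the whole
        disc, because \<open>Re (cnj x * \<zeta> ^ q)\<close> is harmonic in \<open>\<zeta>\<close>,
        while \<open>U\<close> in general is not.\<close>
      obtain x where x: "x \<in> X" "U z = x \<bullet> z ^ q"
        unfolding U_def by (rule support_attained[OF X(1) X'])
      have xRe: "x \<bullet> y = Re (cnj x * y)" for y by (simp add: inner_complex_def)
      have GU: "U z \<le> Re (G z)" using Gpos[OF zr x(1)] x(2) xRe by simp
      have fB: "norm (f \<zeta>) \<le> exp (B z)" if \<zeta>: "\<zeta> \<in> cball z s" for \<zeta>
      proof -
        have d: "dist z \<zeta> \<le> s" using \<zeta> by simp
        have \<zeta>r: "norm \<zeta> \<le> r" using d s by (intro ball) simp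
        have v: "Re (v z) \<le> 3 * Re (v \<zeta>)"
          by (rule Harnack_half_disc[OF _ _ s(1) d])
            (use hv vpos ball in \<open>auto intro: holomorphic_on_subset\<close>)
        have "Re (G \<zeta> - cnj x * \<zeta> ^ q) \<le> 3 * Re (G z - cnj x * z ^ q)"
        proof (rule Harnack_half_disc[OF _ _ s(1) d])
          show "(\<lambda>z. G z - cnj x * z ^ q) holomorphic_on ball z (2 * s)"
            using G(1) by (auto intro!: holomorphic_intros intro: holomorphic_on_subset)
          show "0 \<le> Re (G y - cnj x * y ^ q)" if "y \<in> ball z (2 * s)" for y
            using that x by (intro Gpos ball) auto
        qed
        then have 1: "Re (G \<zeta>) - x \<bullet> \<zeta> ^ q \<le> 3 * (Re (G z) - U z)"
          unfolding x(2) by (simp only: minus_complex.sel xRe)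
        have "x \<bullet> \<zeta> ^ q - x \<bullet> z ^ q = x \<bullet> (\<zeta> ^ q - z ^ q)" by (simp add: inner_diff_right)
        also have "\<dots> \<le> norm x * norm (\<zeta> ^ q - z ^ q)" by (rule norm_cauchy_schwarz)
        also have "\<dots> \<le> S * (real q * W)"
        proof (intro mult_mono S x)
          have "norm (\<zeta> ^ q - z ^ q) \<le> real q * r ^ (q - 1) * norm (\<zeta> - z)"
            by (rule norm_power_diff_le[OF \<zeta>r zr])
          also have "\<dots> \<le> real q * r ^ (q - 1) * s"
            using d r by (intro mult_left_mono) (auto simp: dist_norm norm_minus_commute)
          also have "\<dots> = real q * (r ^ k / 4)" unfolding mult.assoc rs ..
          also have "\<dots> \<le> real q * W" using rkW r W by (intro mult_left_mono) auto
          finally show "norm (\<zeta> ^ q - z ^ q) \<le> real q * W" .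
        qed (use S in auto)
        finally have 2: "x \<bullet> \<zeta> ^ q \<le> U z + S * (real q * W)" using x by simp
        have "Re (g \<zeta>) = Re (G \<zeta>) + C1 * W + 1 - Re (v \<zeta>)" by (simp add: v_def)
        also have "\<dots> \<le> U z + S * (real q * W) + 3 * (Re (G z) - U z) + C1 * W + 2 * W - Re (v z) / 3"
          using v 1 2 W by linarith
        also have "\<dots> = B z" by (simp add: B_def C4_def algebra_simps)
        finally show ?thesis using fg[OF \<zeta>r] by (meson exp_le_cancel_iff order_trans)
      qed
      \<comment> \<open>\<open>lo\<close> wants a bound of at least 1, so \<open>B z\<close> must be
        nonnegative. That rests on an upper bound for \<open>v\<close>, which is the positivity of
        \<open>Re g\<close>.\<close>
      have "Re (v z) \<le> Re (G z) + C1 * W + 1" using gpos[OF zr] by (simp add: v_def)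
      moreover have "C1 * W + 2 * W \<le> C4 * W"
        using S W by (simp add: C4_def distrib_right)
      moreover have "0 \<le> C1 * W" using up W by simp
      moreover have "0 \<le> u + c4 + 3 * (g' - u) - v' / 3"
        if "v' \<le> g' + c1 + 1" "c1 + 2 * W \<le> c4" "0 \<le> c1" "u \<le> g'" "0 \<le> u" for u g' v' c1 c4 :: real
        using that W by argo
      ultimately have "0 \<le> B z" using GU Upos[of z] unfolding B_def by blast
      then have "norm (A z) * exp (U z) \<le> exp (C2 * weight k (norm z)) * (1 / s) ^ N * exp (B z)"
        using s fB by (intro lo) auto
      also have "\<dots> \<le> exp (C2 * W) * exp (C5 * W) * exp (B z)"
      proof (intro mult_right_mono mult_mono)
        have "weight k (norm z) \<le> W" unfolding W_def using zr by (intro weight_mono) auto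
        then show "exp (C2 * weight k (norm z)) \<le> exp (C2 * W)" using C2 by (simp add: mult_left_mono)
        have "1 / s = 4 * r ^ p / r" using r by (simp add: s_def)
        also have "\<dots> \<le> 4 * r ^ p" using r by (simp add: divide_le_eq mult_le_cancel_left)
        also have "\<dots> = exp (ln 4 + real p * ln r)"
          using r by (simp add: exp_add exp_of_nat_mult)
        also have "\<dots> \<le> exp ((2 * ln 4 + real p) * W)"
        proof -
          have "ln 4 * (1 / 2) \<le> ln (4::real) * W" using W by (intro mult_left_mono) auto
          moreover have "real p * ln r \<le> real p * W" using lnW by (intro mult_left_mono) auto
          ultimately show ?thesis unfolding exp_le_cancel_iff distrib_right by linarith
        qed
        finally have "(1 / s) ^ N \<le> exp ((2 * ln 4 + real p) * W) ^ N"
          using s by (intro power_mono) auto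
        then show "(1 / s) ^ N \<le> exp (C5 * W)"
          by (simp add: C5_def exp_of_nat_mult[symmetric] mult.assoc)
      qed (use s in auto)
      also have "\<dots> = exp (C6 * W + 3 * (Re (G z) - U z) - Re (v z) / 3) * exp (U z)"
        by (simp add: B_def C6_def distrib_right flip: exp_add)
      finally show ?thesis by simp
    qed
    have cB: "continuous_on T (\<lambda>z. C6 * W + 3 * (Re (G z) - U z) - Re (v z) / 3)" for T
      by (intro continuous_intros cRe G hv cU) auto
    have "c + real n * ln \<rho> \<le> circle_mean (\<lambda>z. C6 * W + 3 * (Re (G z) - U z) - Re (v z) / 3) \<rho>"
      using \<rho> AB cB by (intro J[rule_format]) auto
    \<comment> \<open>The harmonic part contributes its value at 0; what is left is the known mean
      of \<open>U\<close> on the circle of radius \<open>\<rho>\<close>.\<close>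
    also have "\<dots> = circle_mean (\<lambda>z. Re (of_real (C6 * W) + 3 * G z - v z / 3)) \<rho> - circle_mean (\<lambda>z. 3 * U z) \<rho>"
    proof -
      have eq: "(\<lambda>z. C6 * W + 3 * (Re (G z) - U z) - Re (v z) / 3)
        = (\<lambda>z. Re (of_real (C6 * W) + 3 * G z - v z / 3) - 3 * U z)"
        by (simp add: fun_eq_iff)
      show ?thesis unfolding eq
        using \<rho> by (intro circle_mean_diff cRe holomorphic_intros G hv continuous_intros cU) auto
    qed
    also have "circle_mean (\<lambda>z. Re (of_real (C6 * W) + 3 * G z - v z / 3)) \<rho> = C6 * W + 3 * Re (G 0) - Re (v 0) / 3"
      using \<rho> by (subst circle_mean_Re_holomorphic) (auto intro!: holomorphic_intros G hv)
    also have "circle_mean (\<lambda>z. 3 * U z) \<rho> = 3 * (K * \<rho> ^ q)"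
      using \<rho> mU[of \<rho>] by (simp add: circle_mean_cmult)
    finally have 1: "c + real n * ln \<rho> \<le> C6 * W + 3 * Re (G 0) - Re (v 0) / 3 - 3 * (K * \<rho> ^ q)" .
    have "Re (G 0) = circle_mean (\<lambda>z. Re (G z)) r"
      using circle_mean_Re_holomorphic[OF G(1)] r by simp
    moreover have "circle_mean (\<lambda>z. Re (G z)) r \<le> circle_mean (\<lambda>z. U z + 1) r"
      using G r by (intro circle_mean_mono cRe continuous_intros cU) auto
    moreover have "circle_mean U r \<le> circle_mean (\<lambda>z. Re (G z)) r"
      using G r by (intro circle_mean_mono cRe continuous_intros cU) auto
    moreover have "circle_mean (\<lambda>z. U z + 1) r = circle_mean U r + 1"
      using r by (subst circle_mean_add) (auto intro!: cU simp: circle_mean_const)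
    ultimately have 2: "circle_mean U r \<le> Re (G 0)" "Re (G 0) \<le> K * r ^ q + 1"
      using mU[of r] r by auto
    have "Re (g 0) = circle_mean (\<lambda>z. Re (g z)) r"
      using circle_mean_Re_holomorphic[OF g(1)] r by simp
    also have "\<dots> \<le> circle_mean (\<lambda>z. L z + 1) r"
      using g r by (intro circle_mean_mono cRe continuous_intros cL) auto
    also have "\<dots> = circle_mean L r + 1"
      using r by (subst circle_mean_add) (auto intro!: cL simp: circle_mean_const)
    finally have 3: "Re (g 0) \<le> circle_mean L r + 1" .
    have "Re (v 0) = Re (G 0) + C1 * W + 1 - Re (g 0)" by (simp add: v_def)
    moreover have "0 \<le> C1 * W" using up W by simp
    ultimately have 4: "circle_mean U r - circle_mean L r \<le> Re (v 0)" using 2(1) 3 by linarith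
    have 5: "0 \<le> real n * ln \<rho>" using \<rho> by simp
    \<comment> \<open>\<open>G 0\<close> is tied to the mean of \<open>U\<close> at radius
      \<open>r\<close>, whereas Jensen's inequality was used at radius \<open>\<rho>\<close>; this
      is the price of the change.\<close>
    have "K * r ^ q - K * \<rho> ^ q \<le> K * (real q * W)"
      using rq K by (simp add: mult_left_mono flip: right_diff_distrib)
    then have "Re (v 0) / 3 \<le> - c + C6 * W + 3 + 3 * (K * (real q * W))"
      using 1 2 5 by linarith
    also have "\<dots> \<le> \<bar>c\<bar> * (2 * W) + C6 * W + 6 * W + 3 * (K * (real q * W))"
    proof -
      have "\<bar>c\<bar> * 1 \<le> \<bar>c\<bar> * (2 * W)" using W by (intro mult_left_mono) auto
      then show ?thesis using W by linarith
    qed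
    also have "\<dots> = C * W / 3" by (simp add: C_def algebra_simps)
    finally show ?thesis using 4 by (simp add: W_def)
  qed
  then show ?thesis by blast
qed

section \<open>The asymptotic formula for the characteristic\<close>

lemma nevanlinna_characteristic_entire:
  assumes "f holomorphic_on UNIV"
  shows "nevanlinna_characteristic r f = circle_mean (\<lambda>z. max 0 (ln (norm (f z)))) r"
proof -
  have "\<not> is_pole f z" for z
    using not_is_pole_holomorphic[of UNIV z f] assms by simp
  then show ?thesis
    by (simp add: nevanlinna_characteristic_def integrated_counting_function_def pole_count_def
        proximity_function_def circle_mean_def)
qed

theorem theorem3p1:
  fixes p q m :: nat
    and f :: "complex \<Rightarrow> complex"
    and H :: "nat \<Rightarrow> complex \<Rightarrow> complex"
    and w :: "nat \<Rightarrow> complex"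
  assumes "1 \<le> p" and "p \<le> q"
    and "exp_poly_of_order q f"
    and "\<And>z. f z = (\<Sum>j\<le>m. H j z * exp (w j * z ^ q))"
    and "w 0 = 0"
    and "inj_on w {..m}"
    and "\<And>j. 1 \<le> j \<Longrightarrow> j \<le> m \<Longrightarrow> H j \<noteq> (\<lambda>_. 0)"
    and "\<And>j. j \<le> m \<Longrightarrow> \<exists>d\<le>q - p. exp_poly_of_order d (H j)"
  shows "(\<lambda>r. nevanlinna_characteristic r f
              - circumference (convex hull (insert 0 ((\<lambda>j. cnj (w j)) ` {1..m}))) * (r ^ q / (2 * pi)))
         \<in> O[at_top](\<lambda>r. r ^ (q - p) + ln r)"
proof -
  define k where "k = q - p"
  \<comment> \<open>Conjugation turns the real inner product with \<open>z ^ q\<close> into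
    \<open>Re (w j * z ^ q)\<close>, so \<open>support X (z ^ q)\<close> is the maximum of these
    real parts. The element 0 stands for \<open>w 0\<close>.\<close>
  define X where "X = insert 0 ((\<lambda>j. cnj (w j)) ` {1..m})"
  define U where "U = (\<lambda>z. support X (z ^ q))"
  define L where "L = (\<lambda>z. max 0 (ln (norm (f z))))"
  have X: "finite X" "0 \<in> X" "X \<noteq> {}" by (auto simp: X_def)
  have kq: "k < q" using assms(1,2) by (simp add: k_def)
  have cnj_X: "cnj (w j) \<in> X" if "j \<le> m" for j
    using that assms(5) by (cases "j = 0") (auto simp: X_def)
  have inner: "cnj a \<bullet> b = Re (a * b)" for a b by (simp add: inner_complex_def)
  have gH: "growth k (H j)" if "j \<le> m" for j
    using assms(8)[OF that] exp_poly_of_order_growth k_def by blast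
  have f_eq: "f = (\<lambda>z. \<Sum>j\<le>m. H j z * exp (w j * z ^ q))" using assms(4) by blast
  have hf: "f holomorphic_on UNIV"
    unfolding f_eq using gH growth_holomorphic by (auto intro!: holomorphic_intros)
  have U_ge: "Re (w j * z ^ q) \<le> U z" if "j \<le> m" for j z
    using support_mono_point[OF X(1) cnj_X[OF that], of "z ^ q"] by (simp only: U_def inner)
  have U_eq: "\<exists>j\<le>m. U z = Re (w j * z ^ q)" for z
  proof -
    obtain x where x: "x \<in> X" "U z = x \<bullet> z ^ q"
      unfolding U_def by (rule support_attained[OF X(1,3)])
    have "\<exists>j\<le>m. x = cnj (w j)"
      using x(1) assms(5) by (cases "x = 0") (auto simp: X_def intro: exI[of _ 0])
    then obtain j where j: "j \<le> m" "x = cnj (w j)" by blast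
    have "U z = Re (w j * z ^ q)" unfolding x(2) j(2) by (rule inner)
    then show ?thesis using j(1) by blast
  qed
  have U0: "0 \<le> U z" for z using U_ge[of 0 z] assms(5) by simp
  obtain C1 where C1: "0 \<le> C1" "\<And>z. norm (f z) \<le> exp (U z + C1 * weight k (norm z))"
    using exp_sum_upper[of m k H w q U] gH U_ge assms(4) by auto
  obtain A C2 N where A: "A holomorphic_on UNIV" "A \<noteq> (\<lambda>_. 0)" "0 \<le> C2"
    "\<forall>z s M. 0 < s \<longrightarrow> s \<le> 1 \<longrightarrow> 1 \<le> M \<longrightarrow> (\<forall>\<zeta>\<in>cball z s. norm (f \<zeta>) \<le> M) \<longrightarrow>
      norm (A z) * exp (U z) \<le> exp (C2 * weight k (norm z)) * (1 / s) ^ N * M"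
    using exp_sum_lower[OF gH kq assms(5,6,7,4) U_eq] by metis
  have "\<exists>C. \<forall>r\<ge>2. circle_mean (\<lambda>z. support X (z ^ q)) r - circle_mean (\<lambda>z. max 0 (ln (norm (f z)))) r \<le> C * weight k r"
    by (rule circle_mean_lower[where N = N, OF X(1,2) assms(1,2) k_def hf C1(1) _ A(1,2,3)])
      (use C1(2) A(4) in \<open>auto simp: U_def\<close>)
  then obtain C where C: "\<And>r. 2 \<le> r \<Longrightarrow> circle_mean U r - circle_mean L r \<le> C * weight k r"
    unfolding U_def L_def by blast
  have cL: "continuous_on T L" for T
    unfolding L_def using hf holomorphic_on_imp_continuous_on continuous_on_subset
    by (intro positive_log_continuous) blast
  have cU: "continuous_on T U" for T
    unfolding U_def
    by (rule continuous_on_compose2[OF continuous_on_support[OF X(1,3), of UNIV]]) (auto intro!: continuous_intros)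
  define D where "D = max C C1"
  have D: "0 \<le> D" using C1 by (simp add: D_def)
  have bound: "\<bar>circle_mean L r - circle_mean U r\<bar> \<le> D * weight k r" if r: "2 \<le> r" for r
  proof -
    have w: "0 \<le> weight k r" using r by (intro weight_nonneg) auto
    have "circle_mean L r \<le> circle_mean (\<lambda>z. U z + C1 * weight k r) r"
      using r w C1 U0 unfolding L_def
      by (intro circle_mean_mono cL[unfolded L_def] continuous_intros cU positive_log_le add_nonneg_nonneg) auto
    also have "\<dots> = circle_mean U r + C1 * weight k r"
      using r by (subst circle_mean_add) (auto intro!: cU simp: circle_mean_const)
    finally have "circle_mean L r - circle_mean U r \<le> C1 * weight k r" by simp
    moreover have "C1 * weight k r \<le> D * weight k r" "C * weight k r \<le> D * weight k r"
      using w by (auto simp: D_def intro!: mult_right_mono)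
    ultimately show ?thesis using C[OF r] by linarith
  qed
  have "\<forall>\<^sub>F r in at_top. norm (nevanlinna_characteristic r f - circumference (convex hull X) * (r ^ q / (2 * pi)))
    \<le> (2 * D) * norm (r ^ (q - p) + ln r)"
    using eventually_ge_at_top[of "2::real"]
  proof eventually_elim
    case (elim r)
    have "circle_mean U r = r ^ q * (circumference (convex hull X) / (2 * pi))"
      using circle_mean_support_power[OF X(1,3), of r q] Cauchy_perimeter_formula[OF X(1,3)] elim kq
      by (simp add: U_def)
    then have "\<bar>nevanlinna_characteristic r f - circumference (convex hull X) * (r ^ q / (2 * pi))\<bar> \<le> D * weight k r"
      using bound[OF elim] nevanlinna_characteristic_entire[OF hf, of r] by (simp add: L_def mult.commute)
    also have "\<dots> \<le> D * (2 * (r ^ k + ln r))"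
    proof (intro mult_left_mono D)
      \<comment> \<open>For \<open>r \<ge> 2\<close> the shift inside the logarithm of the weight
        costs only a factor 2.\<close>
      have "2 + r \<le> r * r" using mult_right_mono[of 2 r r] elim by linarith
      then have "ln (2 + r) \<le> ln (r * r)" using elim by (intro ln_mono) auto
      also have "\<dots> = 2 * ln r" using elim by (subst ln_mult) auto
      finally have "ln (2 + r) \<le> 2 * ln r" .
      moreover have "0 \<le> r ^ k" using elim by simp
      ultimately show "weight k r \<le> 2 * (r ^ k + ln r)" unfolding weight_def distrib_left by linarith
    qed
    also have "\<dots> = 2 * D * norm (r ^ (q - p) + ln r)"
      using elim by (simp add: k_def)
    finally show ?case by simp
  qed
  then show ?thesis unfolding X_def by (rule bigoI)
qed

end
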